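(* For all integers $c\geq 0$ and $n\geq 0$, we have $$a_{49c+5}(49n+31)\equiv 0\pmod{7}$$ and $$d_{49c+2}(49n+43)\equiv 0\pmod{7}.$$
   Context: For a positive integer $m$, let $f_m := \prod_{k=1}^\infty (1-q^{mk})$, regarded as a formal power series in $q$ with integer coefficients (or as a function of $q\in\mathbb{C}$ with $|q|<1$). For an integer $k\geq 1$, $a_k(n)$ denotes the number of generalized cubic partitions of $n$, i.e. partitions of $n$ whose even parts may appear in $k$ different colors (odd parts have no restrictions and one color), with $a_k(0):=1$; its generating function is $$\sum_{n=0}^\infty a_k(n)q^n = \frac{1}{f_1f_2^{k-1}}.$$ For an integer $k\geq 1$, $d_k(n)$ denotes the number of partitions obtained by adding the links of the $k$-elongated plane partition diamonds of length $n$, with $d_k(0):=1$; for the purposes of this statement the integers $d_k(n)$ are determined by the generating function $$\sum_{n=0}^\infty d_k(n)q^n = \frac{f_2^k}{f_1^{3k+1}}.$$ *)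

theory Defs
  imports
    "HOL-Analysis.Analysis"
    "HOL-Computational_Algebra.Formal_Power_Series"
    "HOL-Library.Multiset"
    "HOL-Number_Theory.Cong"
begin

text \<open>
  The infinite product is taken in the coefficientwise topology on formal power series;
  the index \<open>k\<close> is shifted by one because \<^const>\<open>prodinf\<close> starts at \<open>0\<close>.
\<close>

definition euler_f :: "nat \<Rightarrow> int fps" where
  "euler_f m = (\<Prod>k. 1 - fps_X ^ (m * Suc k))"

lemma euler_f_tendsto_aux:
  assumes "m > 0"
  shows "\<exists>P. (\<lambda>n. \<Prod>k\<le>n. 1 - fps_X ^ (m * Suc k) :: int fps) \<longlonglongrightarrow> P"
proof -
  have nz: "1 - fps_X ^ (m * Suc k) \<noteq> (0 :: int fps)" for k
  proof
    assume "1 - fps_X ^ (m * Suc k) = (0 :: int fps)"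
    then have "fps_nth (1 - fps_X ^ (m * Suc k)) 0 = fps_nth (0 :: int fps) 0"
      by (simp only:)
    then show False
      using assms by simp
  qed
  have "subdegree (1 - fps_X ^ (m * Suc k) - 1 :: int fps) > n" if "k > n" for n k
  proof -
    have "Suc k \<le> m * Suc k"
      using mult_le_mono1[of 1 m "Suc k"] assms by simp
    then show ?thesis
      using that by simp
  qed
  then show ?thesis
    using tendsto_prod_fps[where f = "\<lambda>k. 1 - fps_X ^ (m * Suc k) :: int fps" and g = id, OF nz]
    unfolding id_apply by blast
qed

lemma
  assumes "m > 0"
  shows euler_f_has_prod: "(\<lambda>k. 1 - fps_X ^ (m * Suc k)) has_prod euler_f m"
    and euler_f_nth_0: "fps_nth (euler_f m) 0 = 1"
proof -
  from euler_f_tendsto_aux[OF assms] obtain P :: "int fps"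
    where P: "(\<lambda>n. \<Prod>k\<le>n. 1 - fps_X ^ (m * Suc k)) \<longlonglongrightarrow> P" by blast
  have c: "fps_nth (\<Prod>k\<le>n. 1 - fps_X ^ (m * Suc k) :: int fps) 0 = 1" for n
    using assms by (induction n) auto
  from P have "\<forall>\<^sub>F n in sequentially. fps_nth (\<Prod>k\<le>n. 1 - fps_X ^ (m * Suc k)) 0 = fps_nth P 0"
    unfolding tendsto_fps_iff by blast
  then have P0: "fps_nth P 0 = 1"
    unfolding c by simp
  then have "P \<noteq> 0" by auto
  with P have h: "(\<lambda>k. 1 - fps_X ^ (m * Suc k)) has_prod P"
    by (simp add: has_prod_def raw_has_prod_def)
  then have "P = euler_f m"
    unfolding euler_f_def by (rule has_prod_unique)
  with h P0 show "(\<lambda>k. 1 - fps_X ^ (m * Suc k)) has_prod euler_f m" "fps_nth (euler_f m) 0 = 1"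
    by simp_all
qed

text \<open>
  A coloured part is a pair \<open>(s, c)\<close> of its size \<open>s\<close> and its colour \<open>c\<close>; even parts have
  the colours \<open>0, \<dots>, k - 1\<close>, odd parts only the colour \<open>0\<close>. A partition is a finite
  multiset of coloured parts.
\<close>

definition gen_cubic_partitions :: "nat \<Rightarrow> nat \<Rightarrow> (nat \<times> nat) multiset set" where
  "gen_cubic_partitions k n =
     {P. (\<forall>(s, c) \<in># P. s > 0 \<and> c < (if even s then k else 1)) \<and> (\<Sum>(s, c) \<in># P. s) = n}"

definition gen_cubic_a :: "nat \<Rightarrow> nat \<Rightarrow> nat" where
  "gen_cubic_a k n = card (gen_cubic_partitions k n)"

lemma finite_gen_cubic_partitions: "finite (gen_cubic_partitions k n)"
proof (rule finite_subset)
  let ?A = "{..n} \<times> {..k + 1}"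
  show "gen_cubic_partitions k n \<subseteq> (\<Union>i\<le>n. multisets_of_size ?A i)"
  proof
    fix P assume P: "P \<in> gen_cubic_partitions k n"
    then have ok: "s > 0 \<and> c < (if even s then k else 1)" if "(s, c) \<in># P" for s c
      using that by (auto simp: gen_cubic_partitions_def)
    have sum: "(\<Sum>x \<in># P. fst x) = n"
      using P by (simp add: gen_cubic_partitions_def case_prod_unfold)
    have "s \<le> n \<and> c \<le> k + 1" if sc: "(s, c) \<in># P" for s c
    proof
      obtain Q where "P = add_mset (s, c) Q"
        using sc by (blast dest: multi_member_split)
      then show "s \<le> n"
        using sum by auto
      show "c \<le> k + 1"
        using ok[OF sc] by (auto split: if_splits)
    qed
    then have "set_mset P \<subseteq> ?A"
      by auto
    moreover have "size P \<le> (\<Sum>x \<in># P. fst x)"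
    proof -
      have "1 \<le> fst x" if "x \<in># P" for x
        using ok[of "fst x" "snd x"] that by simp
      then show ?thesis
        unfolding size_eq_sum_mset by (rule sum_mset_mono)
    qed
    ultimately show "P \<in> (\<Union>i\<le>n. multisets_of_size ?A i)"
      using sum by (auto simp: multisets_of_size_def)
  qed
  show "finite (\<Union>i\<le>n. multisets_of_size ?A i)"
    by (intro finite_UN_I) auto
qed

lemma gen_cubic_a_0: "gen_cubic_a k 0 = 1"
proof -
  have "P = {#}" if P: "P \<in> gen_cubic_partitions k 0" for P
  proof (cases P)
    case (add x Q)
    with P show ?thesis
      by (auto simp: gen_cubic_partitions_def case_prod_unfold)
  qed
  moreover have "{#} \<in> gen_cubic_partitions k 0"
    by (simp add: gen_cubic_partitions_def)
  ultimately have "gen_cubic_partitions k 0 = {{#}}"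
    by blast
  then show ?thesis
    by (simp add: gen_cubic_a_def)
qed

text \<open>
  Since \<^typ>\<open>int\<close> is not a field, the quotient of power series is written with
  \<^const>\<open>fps_right_inverse\<close>, whose second argument is the inverse of the constant
  coefficient, here \<open>1\<close>.
\<close>

definition elongated_d :: "nat \<Rightarrow> nat \<Rightarrow> int" where
  "elongated_d k n =
     fps_nth (euler_f 2 ^ k * fps_right_inverse (euler_f 1 ^ (3 * k + 1)) 1) n"

lemma elongated_d_gf:
  "Abs_fps (elongated_d k) * euler_f 1 ^ (3 * k + 1) = euler_f 2 ^ k"
proof -
  have "euler_f 1 ^ (3 * k + 1) * fps_right_inverse (euler_f 1 ^ (3 * k + 1)) 1 = 1"
    by (rule fps_right_inverse) (simp add: fps_power_zeroth euler_f_nth_0)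
  moreover have "Abs_fps (elongated_d k) =
      euler_f 2 ^ k * fps_right_inverse (euler_f 1 ^ (3 * k + 1)) 1"
    by (simp add: fps_eq_iff elongated_d_def)
  ultimately show ?thesis
    by (simp only: mult.assoc mult.commute[of "fps_right_inverse _ _"] mult_1_right)
qed

end

theory Submission
  imports Defs "HOL-Computational_Algebra.Polynomial"
begin

text \<open>
  Write \<open>E m\<close> for \<open>euler_f m\<close>. Since \<open>E m ^ 7 \<equiv> E (7 * m)\<close> modulo 7, both generating functions
  reduce, up to factors that are series in \<open>q ^ 49\<close>, to the case \<open>c = 0\<close>, where they become
  \<open>E 2 ^ 3 / (E 1 * E 14)\<close> and \<open>E 2 ^ 2 / E 7\<close>. The numerators \<open>E 2 ^ 3 / E 1\<close> and \<open>E 2 ^ 2\<close> are theta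
  series of the binary quadratic forms \<open>3 x ^ 2 + 2 y ^ 2\<close> and \<open>x ^ 2 + y ^ 2\<close>, by the identities of Gauss and Euler.
  The prime 7 is inert for \<open>x ^ 2 + y ^ 2\<close>; for \<open>3 x ^ 2 + 2 y ^ 2\<close> it splits, but there a sign-reversing
  reflection of the representations makes the corresponding Hecke eigenvalue vanish. In both cases a single
  residue class modulo 49 survives in the relevant class modulo 7, and in the product with
  \<open>1 / E 14\<close> or \<open>1 / E 7\<close> only coefficients governed by Ramanujan's congruence \<open>p(7 n + 5) \<equiv> 0\<close> remain.
\<close>

unbundle no vec_syntax
unbundle fps_syntax

section \<open>Gaussian binomials and the finite triple product\<close>

text \<open>The q-Pascal rule avoids division, so the base may come from any commutative ring; below
  it is a power of \<open>fps_X\<close> and also a constant polynomial.\<close>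

fun qbinomial :: "'a :: comm_ring_1 \<Rightarrow> nat \<Rightarrow> nat \<Rightarrow> 'a" where
  "qbinomial q n 0 = 1"
| "qbinomial q 0 (Suc k) = 0"
| "qbinomial q (Suc n) (Suc k) = qbinomial q n k + q ^ Suc k * qbinomial q n (Suc k)"

lemma qbinomial_eq_0: "n < k \<Longrightarrow> qbinomial q n k = 0"
  by (induction q n k rule: qbinomial.induct) auto

lemma qbinomial_self: "qbinomial q n n = 1"
  by (induction n) (auto simp: qbinomial_eq_0)

text \<open>The second q-Pascal rule. In the induction step, both terms of the first rule are
  expanded by the second one and regrouped; \<open>k = 0\<close> is separate because its lower term
  has no predecessor index.\<close>

lemma qbinomial_Suc_Suc':
  "k \<le> n \<Longrightarrow> qbinomial q (Suc n) (Suc k) = qbinomial q n (Suc k) + q ^ (n - k) * qbinomial q n k"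
proof (induction n arbitrary: k)
  case 0
  then show ?case by simp
next
  case (Suc n)
  show ?case
  proof (cases "k = Suc n")
    case True
    then show ?thesis by (simp add: qbinomial_eq_0 qbinomial_self)
  next
    case False
    with Suc.prems have k: "k \<le> n" by simp
    show ?thesis
    proof (cases k)
      case 0
      have "qbinomial q (Suc (Suc n)) (Suc 0) = 1 + q * qbinomial q (Suc n) (Suc 0)"
        by simp
      also have "qbinomial q (Suc n) (Suc 0) = qbinomial q n (Suc 0) + q ^ n"
        using Suc.IH[of 0] by simp
      finally show ?thesis
        using 0 by (simp add: algebra_simps)
    next
      case (Suc k')
      have e: "q ^ (Suc k + (n - k)) = q ^ Suc n" "q ^ (n - k' + k) = q ^ Suc n"
        using k Suc by (simp_all del: power_Suc)
      have "qbinomial q (Suc (Suc n)) (Suc k)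
          = qbinomial q (Suc n) k + q ^ Suc k * qbinomial q (Suc n) (Suc k)"
        by simp
      also have "\<dots> = (qbinomial q n k + q ^ (n - k') * qbinomial q n k')
           + q ^ Suc k * (qbinomial q n (Suc k) + q ^ (n - k) * qbinomial q n k)"
        using Suc.IH[of k] Suc.IH[of k'] k Suc by simp
      also have "\<dots> = (qbinomial q n k + q ^ Suc k * qbinomial q n (Suc k))
           + q ^ (n - k') * qbinomial q n k' + q ^ (Suc k + (n - k)) * qbinomial q n k"
        by (simp only: power_add algebra_simps)
      also have "\<dots> = (qbinomial q n k + q ^ Suc k * qbinomial q n (Suc k))
           + q ^ (n - k') * (qbinomial q n k' + q ^ k * qbinomial q n k)"
        unfolding e(1) e(2)[symmetric] by (simp only: power_add algebra_simps)
      also have "\<dots> = qbinomial q (Suc n) (Suc k) + q ^ (Suc n - k) * qbinomial q (Suc n) k"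
        using Suc by simp
      finally show ?thesis .
    qed
  qed
qed

definition qfact :: "'a :: comm_ring_1 \<Rightarrow> nat \<Rightarrow> 'a" where
  "qfact q n = (\<Prod>i<n. 1 - q ^ Suc i)"

lemma qfact_0 [simp]: "qfact q 0 = 1"
  and qfact_Suc: "qfact q (Suc n) = qfact q n * (1 - q ^ Suc n)"
  by (simp_all add: qfact_def)

text \<open>The quotient formula with denominators cleared. The induction rests on the second
  q-Pascal rule and the splitting 1 - q^(n+1) = (1 - q^(n-k')) + q^(n-k') (1 - q^(k'+1)).\<close>

lemma qbinomial_qfact:
  "k \<le> n \<Longrightarrow> qbinomial q n k * qfact q k * qfact q (n - k) = qfact q n"
proof (induction n arbitrary: k)
  case 0
  then show ?case by simp
next
  case (Suc n)
  show ?case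
  proof (cases k)
    case 0
    then show ?thesis by simp
  next
    case [simp]: (Suc k')
    with Suc.prems have k': "k' \<le> n" by simp
    show ?thesis
    proof (cases "k' = n")
      case True
      then show ?thesis by (simp add: qbinomial_self qbinomial_eq_0)
    next
      case False
      with k' have lt: "k' < n" by simp
      then obtain r where r: "n - k' = Suc r" "n - Suc k' = r"
        by (metis Suc_diff_Suc)
      have pw: "q ^ (n - k') * q ^ Suc k' = q ^ Suc n"
        unfolding power_add[symmetric] using k' by simp
      have IH1: "qbinomial q n k' * qfact q k' * qfact q (n - k') = qfact q n"
        using Suc.IH k' by simp
      have IH2: "qbinomial q n k * qfact q k * qfact q (n - k) = qfact q n"
        using Suc.IH[of k] lt by simp
      have "qbinomial q (Suc n) k * qfact q k * qfact q (Suc n - k)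
          = (qbinomial q n k * qfact q k * qfact q (n - k)) * (1 - q ^ (n - k'))
          + q ^ (n - k') * (1 - q ^ Suc k') * (qbinomial q n k' * qfact q k' * qfact q (n - k'))"
        using k' r by (simp only: Suc qbinomial_Suc_Suc' diff_Suc_Suc qfact_Suc algebra_simps)
      also have "\<dots> = qfact q n * (1 - q ^ (n - k') * q ^ Suc k')"
        unfolding IH1 IH2 by (simp del: power_Suc add: algebra_simps)
      also have "\<dots> = qfact q (Suc n)"
        unfolding pw qfact_Suc ..
      finally show ?thesis .
    qed
  qed
qed

text \<open>With \<open>j\<close> running over all integers every triangular number occurs twice, at
  \<open>j\<close> and \<open>1 - j\<close>. This is the source of the factors 2 in the identities
  of Gauss and Jacobi.\<close>

definition tri :: "int \<Rightarrow> nat" where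
  "tri j = nat (j * (j - 1) div 2)"

lemma two_tri: "2 * int (tri j) = j * (j - 1)"
proof -
  have "j * (j - 1) \<ge> 0"
    by (cases "j \<le> 0") (auto simp: zero_le_mult_iff)
  moreover have "even (j * (j - 1))" by simp
  ultimately show ?thesis by (auto simp: tri_def)
qed

lemma tri_Suc: "int (tri (j + 1)) = int (tri j) + j"
  using two_tri[of j] two_tri[of "j + 1"] by (simp add: algebra_simps)

text \<open>Linear growth is all that is needed to make the fibres of the exponent finite and to
  bound the indices contributing to a given coefficient.\<close>

lemma tri_ge: "\<bar>j\<bar> \<le> int (tri j) + 1"
proof -
  have "0 \<le> (j - 1) * (j - 2)" "0 \<le> j * (j + 1)"
    by (cases "j \<le> 1"; cases "j \<le> -1"; auto simp: zero_le_mult_iff)+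
  then show ?thesis
    using two_tri[of j] by (cases "j \<ge> 0") (auto simp: algebra_simps)
qed

text \<open>The coefficient comparison behind both inductions of the finite triple product.\<close>

lemma linear_times_sum:
  fixes z :: "'a :: comm_ring_1"
  assumes "c (Suc N) = 0" "c' 0 = a * c 0"
    and "\<And>k. k \<le> N \<Longrightarrow> c' (Suc k) = a * c (Suc k) + b * c k"
  shows "(a + b * z) * (\<Sum>k\<le>N. c k * z ^ k) = (\<Sum>k\<le>Suc N. c' k * z ^ k)"
proof -
  have "(\<Sum>k\<le>Suc N. c' k * z ^ k)
      = a * c 0 + (\<Sum>k\<le>N. (a * c (Suc k) + b * c k) * z ^ Suc k)"
    unfolding sum.atMost_Suc_shift using assms by (intro arg_cong2[of _ _ _ _ "(+)"] sum.cong) auto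
  also have "\<dots> = (a * c 0 + (\<Sum>k\<le>N. a * c (Suc k) * z ^ Suc k)) + (\<Sum>k\<le>N. b * c k * z ^ Suc k)"
    by (simp add: sum.distrib algebra_simps)
  also have "a * c 0 + (\<Sum>k\<le>N. a * c (Suc k) * z ^ Suc k) = (\<Sum>k\<le>Suc N. a * c k * z ^ k)"
    by (simp only: sum.atMost_Suc_shift) simp
  also have "\<dots> = (\<Sum>k\<le>N. a * c k * z ^ k)"
    using assms(1) by simp
  finally show ?thesis
    unfolding distrib_right by (simp del: sum.atMost_Suc add: sum_distrib_left mult_ac)
qed

text \<open>The factors 1 - q^(i+1)/z of the usual form are multiplied by \<open>z\<close>, so no
  inverse of \<open>z\<close> occurs and the summation index is shifted by \<open>n\<close>. A new
  factor of the second product is absorbed by the first q-Pascal rule, one of the first product by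
  the second rule.\<close>

theorem finite_jacobi_triple_product:
  fixes q z :: "'a :: comm_ring_1"
  shows "(\<Prod>i<m. 1 - z * q ^ i) * (\<Prod>i<n. z - q ^ Suc i)
    = (\<Sum>k\<le>m + n. ((-1) ^ (k + n) * q ^ tri (int k - int n) * qbinomial q (m + n) k) * z ^ k)"
proof (induction m)
  case 0
  show ?case
  proof (induction n)
    case 0
    show ?case by (simp add: tri_def)
  next
    case (Suc n)
    let ?c = "\<lambda>n k. (-1) ^ (k + n) * q ^ tri (int k - int n) * qbinomial q n k"
    have "(- (q ^ Suc n) + 1 * z) * (\<Sum>k\<le>n. ?c n k * z ^ k) = (\<Sum>k\<le>Suc n. ?c (Suc n) k * z ^ k)"
    proof (rule linear_times_sum)
      show "?c n (Suc n) = 0" by (simp add: qbinomial_eq_0)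
      have "tri (- int (Suc n)) = tri (- int n) + Suc n"
        using tri_Suc[of "- int (Suc n)"] by simp
      then show "?c (Suc n) 0 = - (q ^ Suc n) * ?c n 0"
        by (simp add: power_add)
      fix k assume "k \<le> n"
      have "tri (int (Suc k) - int n) + Suc n = tri (int k - int n) + Suc k"
        using tri_Suc[of "int k - int n"] by (simp add: algebra_simps)
      then have "q ^ tri (int (Suc k) - int n) * q ^ Suc n = q ^ tri (int k - int n) * q ^ Suc k"
        unfolding power_add[symmetric] by (rule arg_cong)
      note eq = this
      have "- (q ^ Suc n) * ?c n (Suc k) + 1 * ?c n k
          = (-1) ^ (k + n) * ((q ^ tri (int (Suc k) - int n) * q ^ Suc n) * qbinomial q n (Suc k)
              + q ^ tri (int k - int n) * qbinomial q n k)"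
        by (simp add: algebra_simps)
      also have "\<dots> = ?c (Suc n) (Suc k)"
        unfolding eq by (simp add: algebra_simps)
      finally show "?c (Suc n) (Suc k) = - (q ^ Suc n) * ?c n (Suc k) + 1 * ?c n k"
        by (rule sym)
    qed
    then show ?case
      using Suc by (simp add: mult.commute)
  qed
next
  case (Suc m)
  let ?c = "\<lambda>m k. (-1) ^ (k + n) * q ^ tri (int k - int n) * qbinomial q (m + n) k"
  have "(1 + (- (q ^ m)) * z) * (\<Sum>k\<le>m + n. ?c m k * z ^ k) = (\<Sum>k\<le>Suc (m + n). ?c (Suc m) k * z ^ k)"
  proof (rule linear_times_sum)
    show "?c m (Suc (m + n)) = 0" by (simp add: qbinomial_eq_0)
    show "?c (Suc m) 0 = 1 * ?c m 0" by simp
    fix k assume k: "k \<le> m + n"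
    then have "tri (int (Suc k) - int n) + (m + n - k) = tri (int k - int n) + m"
      using tri_Suc[of "int k - int n"] by (simp add: algebra_simps)
    then have "q ^ tri (int (Suc k) - int n) * q ^ (m + n - k) = q ^ tri (int k - int n) * q ^ m"
      unfolding power_add[symmetric] by (rule arg_cong)
    then show "?c (Suc m) (Suc k) = 1 * ?c m (Suc k) + - (q ^ m) * ?c m k"
      unfolding add_Suc qbinomial_Suc_Suc'[OF k]
      by (simp del: of_nat_Suc add: algebra_simps)
  qed
  moreover have "(\<Prod>i<Suc m. 1 - z * q ^ i) * (\<Prod>i<n. z - q ^ Suc i)
     = (1 + (- (q ^ m)) * z) * ((\<Prod>i<m. 1 - z * q ^ i) * (\<Prod>i<n. z - q ^ Suc i))"
    by (simp add: algebra_simps)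
  ultimately show ?case
    using Suc by simp
qed

section \<open>Limits of finite product identities\<close>

lemma tendsto_mult_fps:
  fixes F G :: "'a \<Rightarrow> 'b :: comm_ring_1 fps"
  assumes "(F \<longlongrightarrow> f) A" "(G \<longlongrightarrow> g) A"
  shows "((\<lambda>x. F x * G x) \<longlongrightarrow> f * g) A"
proof (rule tendsto_fpsI)
  fix n
  have "\<forall>\<^sub>F x in A. \<forall>i\<in>{..n}. F x $ i = f $ i" "\<forall>\<^sub>F x in A. \<forall>i\<in>{..n}. G x $ i = g $ i"
    using assms by (simp_all add: eventually_ball_finite tendsto_fps_iff)
  then show "\<forall>\<^sub>F x in A. (F x * G x) $ n = (f * g) $ n"
    by eventually_elim (simp add: fps_mult_nth)
qed

lemma tendsto_power_fps:
  fixes F :: "'a \<Rightarrow> 'b :: comm_ring_1 fps"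
  assumes "(F \<longlongrightarrow> f) A"
  shows "((\<lambda>x. F x ^ k) \<longlongrightarrow> f ^ k) A"
  by (induction k) (auto intro: tendsto_mult_fps assms)

lemma qfact_nth:
  fixes m n :: nat
  assumes "m > 0" "t \<le> n"
  shows "qfact (fps_X ^ m) n $ t = euler_f m $ t"
proof -
  have step: "qfact (fps_X ^ m :: int fps) (Suc n) $ t = qfact (fps_X ^ m) n $ t" if "t \<le> n" for n
  proof -
    have "t < m * Suc n"
      using that assms(1) by (metis One_nat_def Suc_leI le_imp_less_Suc less_le_trans mult_le_mono1 nat_mult_1)
    then show ?thesis
      by (simp add: qfact_Suc algebra_simps fps_X_power_mult_right_nth flip: power_mult power_Suc power_add)
  qed
  have const: "qfact (fps_X ^ m :: int fps) k $ t = qfact (fps_X ^ m) n $ t" if "n \<le> k" for k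
    using that by (induction k rule: dec_induct) (use step assms(2) in auto)
  have "(\<lambda>n. \<Prod>i\<le>n. 1 - fps_X ^ (m * Suc i) :: int fps) \<longlonglongrightarrow> euler_f m"
    using euler_f_has_prod[OF assms(1)] by (rule has_prod_imp_tendsto)
  then have "\<forall>\<^sub>F k in sequentially. (\<Prod>i\<le>k. 1 - fps_X ^ (m * Suc i) :: int fps) $ t = euler_f m $ t"
    unfolding tendsto_fps_iff by blast
  then obtain k where k: "k \<ge> n" "(\<Prod>i\<le>k. 1 - fps_X ^ (m * Suc i) :: int fps) $ t = euler_f m $ t"
    unfolding eventually_sequentially by (metis nle_le)
  have "(\<Prod>i\<le>k. 1 - fps_X ^ (m * Suc i) :: int fps) = qfact (fps_X ^ m) (Suc k)"
    unfolding qfact_def lessThan_Suc_atMost by (simp only: power_mult)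
  then show ?thesis
    using k const[of "Suc k"] by simp
qed

lemma qfact_tendsto:
  assumes "m > 0" "filterlim g at_top at_top"
  shows "(\<lambda>n. qfact (fps_X ^ m) (g n)) \<longlonglongrightarrow> euler_f m"
proof (rule tendsto_fpsI)
  fix t
  have "\<forall>\<^sub>F n in sequentially. t \<le> g n"
    using assms(2) by (simp add: filterlim_at_top)
  then show "\<forall>\<^sub>F n in sequentially. qfact (fps_X ^ m) (g n) $ t = euler_f m $ t"
    by eventually_elim (rule qfact_nth[OF assms(1)])
qed

lemma euler_f_nonzero: "m > 0 \<Longrightarrow> euler_f m \<noteq> 0"
  using euler_f_nth_0[of m] by auto

definition euler_inv :: "nat \<Rightarrow> int fps" where
  "euler_inv m = fps_right_inverse (euler_f m) 1"

lemma euler_f_inv: "m > 0 \<Longrightarrow> euler_f m * euler_inv m = 1"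
  unfolding euler_inv_def by (rule fps_right_inverse) (simp add: euler_f_nth_0)

lemma euler_inv_f: "m > 0 \<Longrightarrow> euler_inv m * euler_f m = 1"
  using euler_f_inv[of m] by (simp add: mult.commute)

lemma fps_dvd_cutoff:
  fixes f :: "'a :: comm_ring_1 fps"
  shows "fps_X ^ n dvd f \<longleftrightarrow> (\<forall>i<n. f $ i = 0)"
proof
  assume "fps_X ^ n dvd f"
  then show "\<forall>i<n. f $ i = 0"
    by (auto simp: dvd_def fps_X_power_mult_nth)
next
  assume "\<forall>i<n. f $ i = 0"
  then have "f = fps_X ^ n * fps_shift n f"
    by (auto simp: fps_eq_iff fps_X_power_mult_nth)
  then show "fps_X ^ n dvd f"
    by (metis dvd_triv_left)
qed

text \<open>The binomial tends to 1 / \<open>euler_f m\<close> when both \<open>k\<close> and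
  \<open>n - k\<close> grow. Modulo \<open>fps_X ^ Suc t\<close> the three q-factorials in
  \<open>qbinomial_qfact\<close> may be replaced by \<open>euler_f m\<close>, and one factor is then
  cancelled by its inverse.\<close>

lemma qbinomial_times_euler_nth:
  assumes "m > 0" "t \<le> k" "t + k \<le> n"
  shows "(qbinomial (fps_X ^ m) n k * euler_f m) $ t = (if t = 0 then 1 else 0)"
proof -
  let ?B = "qbinomial (fps_X ^ m) n k :: int fps" and ?E = "euler_f m" and ?I = "euler_inv m"
  define r where "r x = qfact (fps_X ^ m) x - ?E" for x
  have r: "fps_X ^ Suc t dvd r x" if "t \<le> x" for x
    using that assms(1) by (simp del: power_Suc add: fps_dvd_cutoff r_def qfact_nth)
  have "?B * (?E + r k) * (?E + r (n - k)) = ?E + r n"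
    using qbinomial_qfact[of k n "fps_X ^ m :: int fps"] assms by (simp add: r_def)
  then have "?B * ?E * ?E - ?E = r n - ?B * ?E * r (n - k) - r k * (?B * (?E + r (n - k)))"
    by (simp add: algebra_simps)
  moreover have "fps_X ^ Suc t dvd (r n - ?B * ?E * r (n - k) - r k * (?B * (?E + r (n - k))))"
    using assms by (intro dvd_diff dvd_mult dvd_mult2 r) auto
  ultimately have "fps_X ^ Suc t dvd (?B * ?E * ?E - ?E) * ?I"
    by (metis dvd_mult2)
  also have "(?B * ?E * ?E - ?E) * ?I = ?B * ?E * (?E * ?I) - ?E * ?I"
    by (simp only: algebra_simps)
  also have "\<dots> = ?B * ?E - 1"
    using euler_f_inv[OF assms(1)] by simp
  finally have "(?B * ?E - 1) $ t = 0"
    by (auto simp: fps_dvd_cutoff simp del: power_Suc)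
  then show ?thesis by simp
qed

text \<open>A theta series given by its exponents and weights. A sum over an infinite set is 0 by
  convention, so finiteness of the fibres of \<open>e\<close> has to be supplied wherever it
  matters.\<close>

definition exponent_series :: "('a \<Rightarrow> nat) \<Rightarrow> ('a \<Rightarrow> int) \<Rightarrow> int fps" where
  "exponent_series e w = Abs_fps (\<lambda>n. \<Sum>j | e j = n. w j)"

lemma exponent_series_mult:
  assumes fin: "\<And>n. finite {i. e i = n}" "\<And>n. finite {j. e' j = n}"
  shows "exponent_series e w * exponent_series e' w'
    = exponent_series (\<lambda>(i, j). e i + e' j) (\<lambda>(i, j). w i * w' j)"
proof (rule fps_ext)
  fix n
  have eq: "{p. (case p of (i, j) \<Rightarrow> e i + e' j) = n}
      = (\<Union>s\<in>{0..n}. {i. e i = s} \<times> {j. e' j = n - s})"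
    by auto
  have "(\<Sum>p | (case p of (i, j) \<Rightarrow> e i + e' j) = n. case p of (i, j) \<Rightarrow> w i * w' j)
      = (\<Sum>s\<in>{0..n}. \<Sum>p\<in>{i. e i = s} \<times> {j. e' j = n - s}. case p of (i, j) \<Rightarrow> w i * w' j)"
    unfolding eq using fin by (intro sum.UNION_disjoint) auto
  also have "\<dots> = (\<Sum>s\<in>{0..n}. (\<Sum>i | e i = s. w i) * (\<Sum>j | e' j = n - s. w' j))"
    by (simp add: sum_product sum.cartesian_product)
  finally show "(exponent_series e w * exponent_series e' w') $ n
      = exponent_series (\<lambda>(i, j). e i + e' j) (\<lambda>(i, j). w i * w' j) $ n"
    by (simp add: exponent_series_def fps_mult_nth)
qed

lemma finite_exponent_fibre:
  fixes e :: "int \<Rightarrow> nat"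
  assumes "\<And>j. \<bar>j\<bar> \<le> int (e j) + 1"
  shows "finite {j. e j = n}"
proof (rule finite_subset)
  show "{j. e j = n} \<subseteq> {- int n - 1..int n + 1}"
  proof
    fix j assume "j \<in> {j. e j = n}"
    then show "j \<in> {- int n - 1..int n + 1}"
      using assms[of j] by auto
  qed
qed auto

text \<open>The limit common to the identities of Euler, Gauss and Jacobi. The arbitrary weight
  \<open>w\<close> also covers the differentiated triple product.\<close>

lemma qbinomial_sum_tendsto:
  fixes w :: "int \<Rightarrow> int" and e :: "int \<Rightarrow> nat"
  assumes d: "d > 0" and e: "\<And>j. \<bar>j\<bar> \<le> int (e j) + 1"
  shows "(\<lambda>n. (\<Sum>k\<le>Suc (2 * n). fps_const (w (int k - int n)) * fps_X ^ e (int k - int n)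
       * qbinomial (fps_X ^ d) (Suc (2 * n)) k) * euler_f d) \<longlonglongrightarrow> exponent_series e w"
proof (rule tendsto_fpsI)
  fix t
  show "\<forall>\<^sub>F n in sequentially. ((\<Sum>k\<le>Suc (2 * n). fps_const (w (int k - int n)) * fps_X ^ e (int k - int n)
       * qbinomial (fps_X ^ d) (Suc (2 * n)) k) * euler_f d) $ t = exponent_series e w $ t"
    \<comment> \<open>If \<open>e j \<le> t\<close> then \<open>\<bar>j\<bar> \<le> t + 1\<close>,
      so for such \<open>n\<close> the index \<open>k = j + n\<close> satisfies both conditions of
      \<open>qbinomial_times_euler_nth\<close>.\<close>
    using eventually_ge_at_top[of "2 * t + 2"]
  proof eventually_elim
    case (elim n)
    let ?N = "Suc (2 * n)"
    have summand: "(fps_const (w (int k - int n)) * fps_X ^ e (int k - int n) * qbinomial (fps_X ^ d) ?N k * euler_f d) $ t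
        = (if e (int k - int n) = t then w (int k - int n) else 0)" for k
    proof -
      let ?j = "int k - int n"
      have "(fps_const (w ?j) * fps_X ^ e ?j * qbinomial (fps_X ^ d) ?N k * euler_f d) $ t
          = w ?j * (fps_X ^ e ?j * (qbinomial (fps_X ^ d) ?N k * euler_f d)) $ t"
        by (simp only: mult.assoc fps_mult_left_const_nth)
      also have "\<dots> = w ?j * (if t < e ?j then 0 else (qbinomial (fps_X ^ d) ?N k * euler_f d) $ (t - e ?j))"
        by (simp only: fps_X_power_mult_nth)
      also have "\<dots> = (if e ?j = t then w ?j else 0)"
      proof (cases "t < e ?j")
        case False
        then have "t - e ?j \<le> k" "t - e ?j + k \<le> ?N"
          using e[of ?j] elim by auto
        then show ?thesis
          using False by (subst qbinomial_times_euler_nth[OF d]) auto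
      qed auto
      finally show ?thesis .
    qed
    have "((\<Sum>k\<le>?N. fps_const (w (int k - int n)) * fps_X ^ e (int k - int n)
        * qbinomial (fps_X ^ d) ?N k) * euler_f d) $ t
        = (\<Sum>k\<le>?N. if e (int k - int n) = t then w (int k - int n) else 0)"
      by (simp only: sum_distrib_right fps_sum_nth summand)
    also have "\<dots> = (\<Sum>k\<in>{k. k \<le> ?N \<and> e (int k - int n) = t}. w (int k - int n))"
      by (subst sum.inter_filter[symmetric]) auto
    also have "\<dots> = (\<Sum>j | e j = t. w j)"
    proof (rule sum.reindex_bij_witness[of _ "\<lambda>j. nat (j + int n)" "\<lambda>k. int k - int n"])
      fix j assume "j \<in> {j. e j = t}"
      then have "\<bar>j\<bar> \<le> int n" using e[of j] elim by auto
      then show "int (nat (j + int n)) - int n = j"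
        "nat (j + int n) \<in> {k. k \<le> ?N \<and> e (int k - int n) = t}"
        using \<open>j \<in> {j. e j = t}\<close> by auto
    qed auto
    finally show ?case by (simp add: exponent_series_def)
  qed
qed

section \<open>The series of Euler, Gauss and Jacobi\<close>

definition parity_sign :: "int \<Rightarrow> int" where
  "parity_sign j = (if even j then 1 else -1)"

lemma fps_const_parity_sign: "fps_const (parity_sign (int k - int n)) = (-1) ^ (k + n)"
  by (cases "even k"; cases "even n") (simp_all add: parity_sign_def flip: fps_const_neg)

text \<open>The generalized pentagonal numbers j (3j - 1) / 2, in the shape in which base q^3 and z
  = q produce them in the triple product.\<close>

definition pent :: "int \<Rightarrow> nat" where
  "pent j = nat (3 * int (tri j) + j)"

lemma two_pent: "2 * int (pent j) = j * (3 * j - 1)"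
proof -
  have "2 * (3 * int (tri j) + j) = j * (3 * j - 1)"
    using two_tri[of j] by (simp add: algebra_simps)
  moreover have "j * (3 * j - 1) \<ge> 0"
    by (cases "j \<le> 0") (auto simp: zero_le_mult_iff)
  ultimately show ?thesis by (auto simp: pent_def)
qed

lemma pent_ge: "\<bar>j\<bar> \<le> int (pent j) + 1"
proof (cases "j \<ge> 0")
  case True
  then show ?thesis using tri_ge[of j] by (simp add: pent_def)
next
  case False
  then have "j * (3 * j - 1 + 2) \<ge> 0"
    by (intro mult_nonpos_nonpos) auto
  then show ?thesis using two_pent[of j] False by (simp add: algebra_simps)
qed

lemma mult_exponent_ge:
  assumes "m > 0" "\<bar>j\<bar> \<le> int e + 1"
  shows "\<bar>j\<bar> \<le> int (m * e) + 1"
proof -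
  have "e \<le> m * e" using assms(1) by simp
  then show ?thesis using assms(2) by linarith
qed

lemma pent_tri: "3 * tri (int k - int n) + k = n + pent (int k - int n)"
  using two_pent[of "int k - int n"] two_tri[of "int k - int n"] by (simp add: algebra_simps)

text \<open>The exponents from 1 to 3n + 1 are sorted by their residue modulo 3.\<close>

lemma qfact_mod_3:
  fixes q :: "'a :: comm_ring_1"
  shows "(\<Prod>i<Suc n. 1 - q * (q ^ 3) ^ i) * (\<Prod>i<n. 1 - q ^ (3 * i + 2)) * qfact (q ^ 3) n
    = qfact q (Suc (3 * n))"
proof (induction n)
  case 0
  show ?case by (simp add: qfact_Suc)
next
  case (Suc n)
  have "q * (q ^ 3) ^ Suc n = q ^ Suc (Suc (Suc (Suc (3 * n))))" "(q ^ 3) ^ Suc n = q ^ Suc (Suc (Suc (3 * n)))"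
    "q ^ (3 * n + 2) = q ^ Suc (Suc (3 * n))" "Suc (3 * Suc n) = Suc (Suc (Suc (Suc (3 * n))))"
    unfolding power_mult[symmetric] power_Suc[symmetric, of q] by (auto intro!: arg_cong[of _ _ "power q"] simp del: power_Suc)
  then have "qfact q (Suc (3 * Suc n)) = qfact q (Suc (3 * n)) * (1 - q ^ (3 * n + 2))
      * (1 - q * (q ^ 3) ^ Suc n) * (1 - (q ^ 3) ^ Suc n)"
    by (simp only: qfact_Suc mult_ac)
  also have "\<dots> = (\<Prod>i<Suc (Suc n). 1 - q * (q ^ 3) ^ i) * (\<Prod>i<Suc n. 1 - q ^ (3 * i + 2)) * qfact (q ^ 3) (Suc n)"
    unfolding Suc[symmetric] qfact_Suc[of "q ^ 3"] prod.lessThan_Suc[of _ "Suc n"] prod.lessThan_Suc[of "\<lambda>i. 1 - q ^ (3 * i + 2)"]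
    by (simp only: mult_ac)
  finally show ?case by (rule sym)
qed

text \<open>Euler's pentagonal number theorem: the triple product with base q^3 and z = q, where q
  is \<open>fps_X ^ m\<close>. The remaining residue class modulo 3 is supplied by
  \<open>euler_f (m * 3)\<close>, which is cancelled at the end.\<close>

theorem euler_f_pentagonal:
  assumes m: "m > 0"
  shows "euler_f m = exponent_series (\<lambda>j. m * pent j) parity_sign"
proof -
  let ?q = "fps_X ^ m :: int fps"
  let ?\<theta> = "exponent_series (\<lambda>j. m * pent j) parity_sign"
  define G where "G n = (\<Sum>k\<le>Suc (2 * n). fps_const (parity_sign (int k - int n))
      * fps_X ^ (m * pent (int k - int n)) * qbinomial (fps_X ^ (m * 3)) (Suc (2 * n)) k)" for n
  have G: "G n = (\<Prod>i<Suc n. 1 - ?q * (?q ^ 3) ^ i) * (\<Prod>i<n. 1 - ?q ^ (3 * i + 2))" for n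
  proof -
    \<comment> \<open>Taking q out of each factor leaves q^n, which matches the q^n that
      \<open>pent_tri\<close> takes out of the sum.\<close>
    have "(\<Prod>i<n. ?q - (?q ^ 3) ^ Suc i) = (\<Prod>i<n. ?q * (1 - ?q ^ (3 * i + 2)))"
    proof (rule prod.cong)
      fix i
      have "(?q ^ 3) ^ Suc i = ?q ^ Suc (3 * i + 2)"
        unfolding power_mult[symmetric, of ?q 3] by (rule arg_cong) simp
      then show "?q - (?q ^ 3) ^ Suc i = ?q * (1 - ?q ^ (3 * i + 2))"
        by (simp only: power_Suc right_diff_distrib mult_1_right)
    qed simp
    also have "\<dots> = ?q ^ n * (\<Prod>i<n. 1 - ?q ^ (3 * i + 2))"
      by (simp add: prod.distrib)
    finally have *: "(\<Prod>i<n. ?q - (?q ^ 3) ^ Suc i) = ?q ^ n * (\<Prod>i<n. 1 - ?q ^ (3 * i + 2))" .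
    have N: "Suc n + n = Suc (2 * n)" by simp
    have summand: "(-1) ^ (k + n) * (?q ^ 3) ^ tri (int k - int n) * qbinomial (?q ^ 3) (Suc (2 * n)) k * ?q ^ k
        = ?q ^ n * (fps_const (parity_sign (int k - int n))
          * fps_X ^ (m * pent (int k - int n)) * qbinomial (fps_X ^ (m * 3)) (Suc (2 * n)) k)" for k
    proof -
      have eq: "(?q ^ 3) ^ tri (int k - int n) * ?q ^ k = ?q ^ n * ?q ^ pent (int k - int n)"
        unfolding power_mult[symmetric, of ?q] power_add[symmetric] pent_tri ..
      have "(-1) ^ (k + n) * (?q ^ 3) ^ tri (int k - int n) * qbinomial (?q ^ 3) (Suc (2 * n)) k * ?q ^ k
        = (-1) ^ (k + n) * qbinomial (?q ^ 3) (Suc (2 * n)) k * ((?q ^ 3) ^ tri (int k - int n) * ?q ^ k)"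
        by (simp only: mult_ac)
      then show ?thesis
        unfolding eq fps_const_parity_sign power_mult[of fps_X] by (simp only: mult_ac)
    qed
    have "?q ^ n * ((\<Prod>i<Suc n. 1 - ?q * (?q ^ 3) ^ i) * (\<Prod>i<n. 1 - ?q ^ (3 * i + 2)))
        = (\<Prod>i<Suc n. 1 - ?q * (?q ^ 3) ^ i) * (\<Prod>i<n. ?q - (?q ^ 3) ^ Suc i)"
      unfolding * by (simp only: mult_ac)
    also have "\<dots> = ?q ^ n * G n"
      unfolding finite_jacobi_triple_product by (simp only: N summand G_def sum_distrib_left)
    finally have "?q ^ n * ((\<Prod>i<Suc n. 1 - ?q * (?q ^ 3) ^ i) * (\<Prod>i<n. 1 - ?q ^ (3 * i + 2))) = ?q ^ n * G n" .
    then show ?thesis by simp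
  qed
  have lim: "(\<lambda>n. G n * euler_f (m * 3)) \<longlonglongrightarrow> ?\<theta>"
    unfolding G_def using m by (intro qbinomial_sum_tendsto mult_exponent_ge pent_ge) auto
  have fl: "filterlim (\<lambda>n::nat. Suc (3 * n)) at_top at_top" "filterlim (\<lambda>n::nat. n) at_top at_top"
    by (auto intro!: filterlim_subseq strict_monoI simp: filterlim_ident)
  have "(\<lambda>n. G n * euler_f (m * 3) * qfact (fps_X ^ (m * 3)) n) \<longlonglongrightarrow> ?\<theta> * euler_f (m * 3)"
    using m by (intro tendsto_mult_fps lim qfact_tendsto fl) auto
  moreover have "G n * euler_f (m * 3) * qfact (fps_X ^ (m * 3)) n = qfact ?q (Suc (3 * n)) * euler_f (m * 3)" for n
    unfolding qfact_mod_3[symmetric] G power_mult by (simp only: mult_ac)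
  ultimately have "(\<lambda>n. qfact ?q (Suc (3 * n)) * euler_f (m * 3)) \<longlonglongrightarrow> ?\<theta> * euler_f (m * 3)"
    by (simp only:)
  moreover have "(\<lambda>n. qfact ?q (Suc (3 * n)) * euler_f (m * 3)) \<longlonglongrightarrow> euler_f m * euler_f (m * 3)"
    using m by (intro tendsto_mult_fps qfact_tendsto fl tendsto_const)
  ultimately have "?\<theta> * euler_f (m * 3) = euler_f m * euler_f (m * 3)"
    by (rule LIMSEQ_unique)
  then show ?thesis
    using m euler_f_nonzero[of "m * 3"] by simp
qed

text \<open>The triple product at z = -1: the factor with \<open>i = 0\<close> is 2, and the others
  pair up to the squares of 1 + q^i. Multiplication by the square of \<open>euler_f 1\<close> turns
  these into factors 1 - q^(2i).\<close>

theorem euler_f_gauss: "2 * euler_f 2 ^ 2 = exponent_series tri (\<lambda>_. 1) * euler_f 1"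
proof -
  let ?\<theta> = "exponent_series tri (\<lambda>_. 1)"
  define G where "G n = (\<Sum>k\<le>Suc (2 * n). fps_const 1 * fps_X ^ tri (int k - int n)
      * qbinomial (fps_X ^ 1) (Suc (2 * n)) k :: int fps)" for n
  have G: "G n = 2 * (\<Prod>i<n. 1 + fps_X ^ Suc i) ^ 2" for n
  proof -
    have 1: "(\<Prod>i<Suc n. 1 - (-1) * fps_X ^ i :: int fps) = 2 * (\<Prod>i<n. 1 + fps_X ^ Suc i)"
      unfolding prod.lessThan_Suc_shift by simp
    have 2: "(\<Prod>i<n. (-1) - fps_X ^ Suc i :: int fps) = (-1) ^ n * (\<Prod>i<n. 1 + fps_X ^ Suc i)"
      by (induction n) (auto simp: algebra_simps)
    have N: "Suc n + n = Suc (2 * n)" by simp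
    have summand: "(-1) ^ (k + n) * fps_X ^ tri (int k - int n) * qbinomial fps_X (Suc (2 * n)) k * (-1) ^ k
        = (-1) ^ n * (fps_const 1 * fps_X ^ tri (int k - int n) * qbinomial (fps_X ^ 1) (Suc (2 * n)) k :: int fps)" for k
    proof -
      have "(-1) ^ (k + n) * (-1) ^ k = ((-1) ^ n :: int fps)"
        by (cases "even k"; cases "even n") auto
      then have "((-1) ^ (k + n) * (-1) ^ k) * (x * y) = (-1) ^ n * (x * y)" for x y :: "int fps"
        by (rule arg_cong)
      from this[of "fps_X ^ tri (int k - int n)" "qbinomial fps_X (Suc (2 * n)) k"] show ?thesis
        by (simp only: fps_const_1_eq_1 mult_1 power_one_right mult_ac)
    qed
    have "(-1) ^ n * (2 * (\<Prod>i<n. 1 + fps_X ^ Suc i) ^ 2)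
        = (\<Prod>i<Suc n. 1 - (-1) * fps_X ^ i) * (\<Prod>i<n. (-1) - fps_X ^ Suc i :: int fps)"
      unfolding 1 2 power2_eq_square by (simp only: mult_ac)
    also have "\<dots> = (-1) ^ n * G n"
      unfolding finite_jacobi_triple_product by (simp only: N summand G_def sum_distrib_left)
    finally have "(-1) ^ n * (2 * (\<Prod>i<n. 1 + fps_X ^ Suc i) ^ 2) = (-1) ^ n * G n" .
    then show ?thesis by simp
  qed
  have q: "(\<Prod>i<n. 1 + fps_X ^ Suc i) * qfact (fps_X ^ 1) n = (qfact (fps_X ^ 2) n :: int fps)" for n
  proof -
    have "(1 + fps_X ^ Suc i) * (1 - (fps_X ^ 1) ^ Suc i) = (1 - (fps_X ^ 2) ^ Suc i :: int fps)" for i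
      unfolding power_mult[symmetric] mult_2 power_add by (simp add: algebra_simps)
    then show ?thesis
      unfolding qfact_def prod.distrib[symmetric] by (simp only:)
  qed
  have lim: "(\<lambda>n. G n * euler_f 1) \<longlonglongrightarrow> ?\<theta>"
    unfolding G_def by (intro qbinomial_sum_tendsto tri_ge) auto
  have "(\<lambda>n. G n * euler_f 1 * qfact (fps_X ^ 1) n ^ 2) \<longlonglongrightarrow> ?\<theta> * euler_f 1 ^ 2"
    by (intro tendsto_mult_fps tendsto_power_fps lim qfact_tendsto filterlim_ident) auto
  moreover have "G n * euler_f 1 * qfact (fps_X ^ 1) n ^ 2 = 2 * qfact (fps_X ^ 2) n ^ 2 * euler_f 1" for n
    unfolding q[symmetric] G by (simp only: power_mult_distrib mult_ac)
  ultimately have "(\<lambda>n. 2 * qfact (fps_X ^ 2) n ^ 2 * euler_f 1) \<longlonglongrightarrow> ?\<theta> * euler_f 1 ^ 2"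
    by (simp only:)
  moreover have "(\<lambda>n. 2 * qfact (fps_X ^ 2) n ^ 2 * euler_f 1) \<longlonglongrightarrow> 2 * euler_f 2 ^ 2 * euler_f 1"
    by (intro tendsto_mult_fps tendsto_power_fps tendsto_const qfact_tendsto filterlim_ident) auto
  ultimately have "?\<theta> * euler_f 1 ^ 2 = 2 * euler_f 2 ^ 2 * euler_f 1"
    by (rule LIMSEQ_unique)
  then have "(?\<theta> * euler_f 1) * euler_f 1 = 2 * euler_f 2 ^ 2 * euler_f 1"
    by (simp add: power2_eq_square mult_ac)
  then show ?thesis
    using euler_f_nonzero[of 1] by (metis mult_cancel_right zero_less_one)
qed

lemma const_poly_power: "[:q:] ^ n = [:q ^ n :: 'a :: comm_ring_1:]"
  by (induction n) (auto simp: one_pCons)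

text \<open>Prepares the triple product over polynomials, with \<open>z\<close> as the
  indeterminate, so that it can be differentiated.\<close>

lemma qbinomial_const_poly: "qbinomial [:q:] n k = [:qbinomial q n k:]"
  by (induction q n k rule: qbinomial.induct) (auto simp: one_pCons const_poly_power simp del: power_Suc)

lemma qfact_square_sum:
  fixes q :: "'a :: idom"
  defines "c \<equiv> \<lambda>n k. (-1) ^ (k + n) * q ^ tri (int k - int n) * qbinomial q (Suc (2 * n)) k"
  shows "(\<Sum>k\<le>Suc (2 * n). c n k) = 0"
    and "(\<Sum>k\<le>Suc (2 * n). c n k * of_nat k) = - (qfact q n ^ 2)"
proof -
  have N: "Suc n + n = Suc (2 * n)" by simp
  let ?z = "[:0, 1:] :: 'a poly"
  txt \<open>The two sums are the value and the derivative at \<open>z = 1\<close> of the finite triple product, which has the factor \<open>1 - z\<close>.\<close>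
  show "(\<Sum>k\<le>Suc (2 * n). c n k) = 0"
    using finite_jacobi_triple_product[of 1 q "Suc n" n]
    unfolding prod.lessThan_Suc_shift N c_def by simp
  let ?A = "(\<Prod>i<n. 1 - ?z * [:q:] ^ Suc i)" and ?B = "(\<Prod>i<n. ?z - [:q:] ^ Suc i)"
  have poly_A: "poly ?A 1 = qfact q n"
    unfolding qfact_def by (simp add: poly_prod const_poly_power del: power_Suc)
  have "poly ?B 1 = qfact q n"
    unfolding qfact_def by (simp add: poly_prod const_poly_power del: power_Suc)
  have const: "(-1) ^ (k + n) * [:q:] ^ tri (int k - int n) * qbinomial [:q:] (Suc (2 * n)) k = [:c n k:]" for k
  proof -
    have "(-1 :: 'a poly) = [:-1:]" by (simp add: one_pCons)
    then show ?thesis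
      by (simp add: c_def const_poly_power qbinomial_const_poly)
  qed
  have "(1 - ?z) * (?A * ?B) = (\<Sum>k\<le>Suc (2 * n). [:c n k:] * ?z ^ k)"
    using finite_jacobi_triple_product[of ?z "[:q:]" "Suc n" n]
    unfolding prod.lessThan_Suc_shift N const by (simp add: mult.assoc)
  then have "poly (pderiv ((1 - ?z) * (?A * ?B))) 1 = poly (pderiv (\<Sum>k\<le>Suc (2 * n). [:c n k:] * ?z ^ k)) 1"
    by (rule arg_cong)
  \<comment> \<open>At 1 only the term in which 1 - z is differentiated survives.\<close>
  moreover have "poly (pderiv ((1 - ?z) * (?A * ?B))) 1 = - (qfact q n ^ 2)"
    using poly_A \<open>poly ?B 1 = qfact q n\<close>
    by (simp only: pderiv_mult) (simp add: pderiv_diff pderiv_pCons power2_eq_square)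
  moreover have "poly (pderiv (\<Sum>k\<le>Suc (2 * n). [:c n k:] * ?z ^ k)) 1
      = (\<Sum>k\<le>Suc (2 * n). c n k * of_nat k)"
  proof -
    have "poly (pderiv ([:c n k:] * ?z ^ k)) 1 = c n k * of_nat k" for k
      by (cases k) (simp_all only: pderiv_mult pderiv_power_Suc, simp_all add: pderiv_pCons)
    moreover have "pderiv (\<Sum>k\<le>N. p k) = (\<Sum>k\<le>N. pderiv (p k))" for p :: "nat \<Rightarrow> 'a poly" and N
      using higher_pderiv_sum[of 1 p] by simp
    ultimately show ?thesis
      by (simp only: poly_sum)
  qed
  ultimately show "(\<Sum>k\<le>Suc (2 * n). c n k * of_nat k) = - (qfact q n ^ 2)"
    by simp
qed

text \<open>With \<open>k = j + n\<close> the weight 1 - 2j is (2n + 1) - 2k, so the finite sum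
  combines the two sums of \<open>qfact_square_sum\<close>: the first vanishes, the second gives the
  square of the q-factorial. The limit of the binomials supplies the third factor.\<close>

theorem euler_f_cube:
  assumes m: "m > 0"
  shows "2 * euler_f m ^ 3 = exponent_series (\<lambda>j. m * tri j) (\<lambda>j. parity_sign j * (1 - 2 * j))"
proof -
  let ?\<theta> = "exponent_series (\<lambda>j. m * tri j) (\<lambda>j. parity_sign j * (1 - 2 * j))"
  define c where "c n k = (-1) ^ (k + n) * (fps_X ^ m) ^ tri (int k - int n)
      * qbinomial (fps_X ^ m :: int fps) (Suc (2 * n)) k" for n k
  define G where "G n = (\<Sum>k\<le>Suc (2 * n). fps_const (parity_sign (int k - int n) * (1 - 2 * (int k - int n)))
      * fps_X ^ (m * tri (int k - int n)) * qbinomial (fps_X ^ m) (Suc (2 * n)) k :: int fps)" for n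
  have "G n = 2 * qfact (fps_X ^ m) n ^ 2" for n
  proof -
    have "fps_const (parity_sign (int k - int n) * (1 - 2 * (int k - int n)))
      * fps_X ^ (m * tri (int k - int n)) * qbinomial (fps_X ^ m) (Suc (2 * n)) k
      = of_nat (Suc (2 * n)) * c n k - 2 * (c n k * of_nat k)" for k
    proof -
      have eq: "fps_const (1 - 2 * (int k - int n)) = of_nat (Suc (2 * n)) - 2 * of_nat k"
        by (simp add: fps_of_nat[symmetric] fps_numeral_fps_const algebra_simps)
      show ?thesis
        unfolding fps_const_mult[symmetric] fps_const_parity_sign eq c_def power_mult
        by (simp only: algebra_simps)
    qed
    then have "G n = of_nat (Suc (2 * n)) * (\<Sum>k\<le>Suc (2 * n). c n k) - 2 * (\<Sum>k\<le>Suc (2 * n). c n k * of_nat k)"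
      unfolding G_def by (simp only: sum_subtractf sum_distrib_left)
    then show ?thesis
      unfolding c_def qfact_square_sum by simp
  qed
  moreover have "(\<lambda>n. G n * euler_f m) \<longlonglongrightarrow> ?\<theta>"
    unfolding G_def using m by (intro qbinomial_sum_tendsto mult_exponent_ge tri_ge) auto
  moreover have "(\<lambda>n. 2 * qfact (fps_X ^ m) n ^ 2 * euler_f m) \<longlonglongrightarrow> 2 * euler_f m ^ 2 * euler_f m"
    by (intro tendsto_mult_fps tendsto_power_fps tendsto_const qfact_tendsto filterlim_ident m)
  ultimately have "?\<theta> = 2 * euler_f m ^ 2 * euler_f m"
    by (simp add: LIMSEQ_unique)
  then show ?thesis
    by (simp add: power2_eq_square power3_eq_cube mult_ac)
qed

section \<open>Congruences modulo 7\<close>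

definition fps_cong :: "int \<Rightarrow> int fps \<Rightarrow> int fps \<Rightarrow> bool" where
  "fps_cong p F G \<longleftrightarrow> (\<forall>n. [F $ n = G $ n] (mod p))"

lemma fps_cong_refl: "fps_cong p F F"
  and fps_cong_sym: "fps_cong p F G \<Longrightarrow> fps_cong p G F"
  and fps_cong_trans [trans]: "fps_cong p F G \<Longrightarrow> fps_cong p G H \<Longrightarrow> fps_cong p F H"
  by (auto simp: fps_cong_def intro: cong_sym cong_trans)

lemma fps_cong_mult: "fps_cong p F F' \<Longrightarrow> fps_cong p G G' \<Longrightarrow> fps_cong p (F * G) (F' * G')"
  by (auto simp: fps_cong_def fps_mult_nth intro!: cong_sum cong_mult)

lemma fps_cong_power: "fps_cong p F G \<Longrightarrow> fps_cong p (F ^ k) (G ^ k)"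
  by (induction k) (auto intro: fps_cong_mult fps_cong_refl)

lemma fps_cong_add_multiple: "fps_cong p (F + fps_const p * G) F"
  by (simp add: fps_cong_def cong_iff_dvd_diff)

lemma fps_cong_dvd: "fps_cong p F G \<Longrightarrow> p dvd G $ n \<Longrightarrow> p dvd F $ n"
  unfolding fps_cong_def by (metis cong_dvd_iff)

section \<open>Power series in q^m\<close>

definition fps_supported :: "nat \<Rightarrow> int fps \<Rightarrow> bool" where
  "fps_supported m F \<longleftrightarrow> (\<forall>n. F $ n \<noteq> 0 \<longrightarrow> m dvd n)"

lemma fps_supported_one: "fps_supported m 1"
  by (simp add: fps_supported_def)

lemma fps_supported_mult:
  assumes "fps_supported m F" "fps_supported m G"
  shows "fps_supported m (F * G)"
  unfolding fps_supported_def
proof (intro allI impI)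
  fix n assume "(F * G) $ n \<noteq> 0"
  then obtain i where i: "i \<le> n" "F $ i \<noteq> 0" "G $ (n - i) \<noteq> 0"
    unfolding fps_mult_nth by (metis (no_types, lifting) atLeastAtMost_iff mult_eq_0_iff sum.neutral)
  then have "m dvd i + (n - i)"
    using assms unfolding fps_supported_def by (blast intro: dvd_add)
  then show "m dvd n" using i by simp
qed

lemma fps_supported_power: "fps_supported m F \<Longrightarrow> fps_supported m (F ^ k)"
  by (induction k) (auto intro: fps_supported_mult fps_supported_one)

lemma fps_supported_dvd: "fps_supported m F \<Longrightarrow> k dvd m \<Longrightarrow> fps_supported k F"
  unfolding fps_supported_def using dvd_trans by blast

text \<open>In the recursion for the coefficients of the inverse, a nonzero term would need both
  \<open>i\<close> and \<open>n - i\<close> to be multiples of \<open>m\<close>.\<close>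

lemma fps_supported_inverse:
  assumes F: "fps_supported m F" "F $ 0 = 1" and FG: "F * G = 1"
  shows "fps_supported m G"
proof -
  have "G $ n \<noteq> 0 \<longrightarrow> m dvd n" for n
  proof (induction n rule: less_induct)
    case (less n)
    show ?case
    proof (rule impI, rule ccontr)
      assume n: "G $ n \<noteq> 0" "\<not> m dvd n"
      have "(\<Sum>i\<in>{1..n}. F $ i * G $ (n - i)) = 0"
      proof (rule sum.neutral, rule ballI, rule ccontr)
        fix i assume i: "i \<in> {1..n}" "F $ i * G $ (n - i) \<noteq> 0"
        then have "m dvd i" "m dvd n - i"
          using F(1) less[of "n - i"] by (auto simp: fps_supported_def)
        then have "m dvd i + (n - i)" by (rule dvd_add)
        then show False using i n by simp
      qed
      then have "(F * G) $ n = G $ n"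
        using F(2) by (simp add: fps_mult_nth sum.atLeast_Suc_atMost)
      then show False using n FG by (auto split: if_splits)
    qed
  qed
  then show ?thesis by (simp add: fps_supported_def)
qed

text \<open>Multiplying by a series in q^m mixes only coefficients whose indices agree modulo
  \<open>m\<close>. This removes the factors depending on \<open>c\<close> from the final
  congruences.\<close>

lemma dvd_nth_mult_supported:
  assumes F: "\<And>n. n mod m = r \<Longrightarrow> p dvd F $ n" and G: "fps_supported m G" and n: "n mod m = r"
  shows "p dvd (F * G) $ n"
  unfolding fps_mult_nth
proof (rule dvd_sum)
  fix i assume i: "i \<in> {0..n}"
  show "p dvd F $ i * G $ (n - i)"
  proof (cases "G $ (n - i) = 0")
    case False
    then have "m dvd n - i" using G by (simp add: fps_supported_def)
    then obtain k where "n = i + m * k"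
      using i by (metis atLeastAtMost_iff dvd_def le_add_diff_inverse)
    then have "i mod m = r" using n by simp
    then show ?thesis using F by simp
  qed auto
qed

section \<open>Euler products modulo 7\<close>

lemma fps_supported_euler_f: "m > 0 \<Longrightarrow> fps_supported m (euler_f m)"
  by (auto simp: fps_supported_def euler_f_pentagonal exponent_series_def elim!: sum.not_neutral_contains_not_neutral)

lemma fps_supported_euler_inv: "m > 0 \<Longrightarrow> fps_supported m (euler_inv m)"
  by (rule fps_supported_inverse[OF fps_supported_euler_f euler_f_nth_0 euler_f_inv])

lemma one_minus_power_7:
  fixes x :: "'a :: idom"
  shows "(1 - x) ^ 7 = (1 - x ^ 7) + 7 * (- x + 3 * x ^ 2 - 5 * x ^ 3 + 5 * x ^ 4 - 3 * x ^ 5 + x ^ 6)"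
  by algebra

text \<open>Frobenius is applied to each factor of the finite products; a fixed coefficient of these
  eventually agrees with that of the infinite product.\<close>

lemma euler_f_power_7:
  assumes m: "m > 0"
  shows "fps_cong 7 (euler_f m ^ 7) (euler_f (7 * m))"
  unfolding fps_cong_def
proof
  fix t
  have fin: "fps_cong 7 (qfact (fps_X ^ m) n ^ 7) (qfact (fps_X ^ (7 * m)) n)" for n
  proof (induction n)
    case 0
    show ?case by (simp add: fps_cong_refl)
  next
    case (Suc n)
    let ?x = "(fps_X ^ m) ^ Suc n :: int fps"
    have "fps_cong 7 ((1 - ?x) ^ 7) (1 - ?x ^ 7)"
      unfolding one_minus_power_7 numeral_fps_const[of "num.Bit1 (num.Bit1 num.One)"]
      by (rule fps_cong_add_multiple)
    moreover have "?x ^ 7 = (fps_X ^ (7 * m)) ^ Suc n"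
      unfolding power_mult[symmetric] by (simp only: mult_ac)
    ultimately show ?case
      unfolding qfact_Suc power_mult_distrib using Suc by (simp only: fps_cong_mult)
  qed
  have "\<forall>\<^sub>F n in sequentially. (qfact (fps_X ^ m) n ^ 7) $ t = (euler_f m ^ 7) $ t"
    using tendsto_power_fps[OF qfact_tendsto[OF m filterlim_ident]] unfolding tendsto_fps_iff by blast
  moreover have "\<forall>\<^sub>F n in sequentially. qfact (fps_X ^ (7 * m)) n $ t = euler_f (7 * m) $ t"
    using qfact_tendsto[OF _ filterlim_ident, of "7 * m"] m unfolding tendsto_fps_iff by simp
  ultimately have "\<forall>\<^sub>F n in sequentially. [(euler_f m ^ 7) $ t = euler_f (7 * m) $ t] (mod 7)"
    by eventually_elim (use fin in \<open>metis fps_cong_def\<close>)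
  then show "[(euler_f m ^ 7) $ t = euler_f (7 * m) $ t] (mod 7)"
    by simp
qed

lemma euler_f_power_7_mult: "m > 0 \<Longrightarrow> fps_cong 7 (euler_f m ^ (7 * k)) (euler_f (7 * m) ^ k)"
  unfolding power_mult by (intro fps_cong_power euler_f_power_7)

section \<open>Sums of two squares and Ramanujan's congruence modulo 7\<close>

lemma sum_two_squares_dvd_7:
  fixes a b :: int
  assumes "7 dvd a ^ 2 + b ^ 2"
  shows "7 dvd a" "7 dvd b"
proof -
  have "((a mod 7) ^ 2 + (b mod 7) ^ 2) mod 7 = ((a mod 7) ^ 2 mod 7 + (b mod 7) ^ 2 mod 7) mod 7"
    by (rule mod_add_eq[symmetric])
  also have "\<dots> = (a ^ 2 + b ^ 2) mod 7"
    unfolding power_mod by (rule mod_add_eq)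
  also have "\<dots> = 0" using assms by simp
  finally have sq: "((a mod 7) ^ 2 + (b mod 7) ^ 2) mod 7 = 0" .
  have res: "a mod 7 \<in> {0, 1, 2, 3, 4, 5, 6}" "b mod 7 \<in> {0, 1, 2, 3, 4, 5, 6}"
    using pos_mod_bound[of 7 a] pos_mod_sign[of 7 a] pos_mod_bound[of 7 b] pos_mod_sign[of 7 b]
    unfolding insert_iff empty_iff by linarith+
  \<comment> \<open>This expresses that -1 is not a square modulo 7; all pairs of residues are
    checked.\<close>
  have "x = 0 \<and> y = 0"
    if "(x ^ 2 + y ^ 2) mod 7 = 0" "x \<in> {0, 1, 2, 3, 4, 5, 6}" "y \<in> {0, 1, 2, 3, 4, 5, 6}" for x y :: int
    using that by (elim insertE emptyE) simp_all
  from this[OF sq res] show "7 dvd a" "7 dvd b"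
    by (simp_all only: dvd_eq_mod_eq_0)
qed

text \<open>In the square of Jacobi's series, completing squares turns an exponent 5m modulo 7m into
  a sum of two odd squares divisible by 7. Both roots are weights up to sign, so 7 divides each
  term. The factor 4 comes from squaring the doubled cube.\<close>

lemma euler_f_pow_6_dvd_7:
  assumes m: "m > 0" and n: "n mod (7 * m) = 5 * m"
  shows "7 dvd (4 * euler_f m ^ 6) $ n"
proof -
  let ?e = "\<lambda>j. m * tri j" and ?w = "\<lambda>j. parity_sign j * (1 - 2 * j)"
  have "4 * euler_f m ^ 6 = (2 * euler_f m ^ 3) * (2 * euler_f m ^ 3)"
    by (simp flip: power_add)
  also have "\<dots> = exponent_series (\<lambda>(i, j). ?e i + ?e j) (\<lambda>(i, j). ?w i * ?w j)"
    unfolding euler_f_cube[OF m]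
    by (intro exponent_series_mult finite_exponent_fibre mult_exponent_ge tri_ge m)
  also have "7 dvd \<dots> $ n"
  proof -
    have "7 dvd ?w i * ?w j" if "m * tri i + m * tri j = n" for i j
    proof -
      have "m * ((tri i + tri j) mod 7) = m * 5"
        using n that by (simp add: mult_mod_right distrib_left mult.commute)
      then have "(tri i + tri j) mod 7 = 5"
        using m by simp
      then have "7 dvd 8 * (int (tri i) + int (tri j)) + 2"
        by presburger
      moreover have "8 * (int (tri i) + int (tri j)) + 2 = (1 - 2 * i) ^ 2 + (1 - 2 * j) ^ 2"
        using two_tri[of i] two_tri[of j] by (simp add: power2_eq_square algebra_simps)
      ultimately have "7 dvd (1 - 2 * i) ^ 2 + (1 - 2 * j) ^ 2"
        by (simp only:)
      then have "7 dvd 1 - 2 * i"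
        by (rule sum_two_squares_dvd_7)
      then show ?thesis by simp
    qed
    then show ?thesis
      unfolding exponent_series_def by (auto intro!: dvd_sum)
  qed
  finally show ?thesis .
qed

text \<open>The coefficient of q^(mk) is the partition number p(k). The inverse is E^6 / E^7 with E
  = \<open>euler_f m\<close>, and modulo 7 the denominator becomes a series in q^(7m).\<close>

theorem ramanujan_mod_7:
  assumes m: "m > 0" and n: "n mod (7 * m) = 5 * m"
  shows "7 dvd euler_inv m $ n"
proof -
  let ?E = "euler_f m" and ?I = "euler_inv m" and ?I7 = "euler_inv (7 * m)"
  have I7: "?I7 * euler_f (7 * m) = 1" using m by (simp add: euler_inv_f)
  have "4 * ?I = 4 * ?I * (?I7 * euler_f (7 * m))"
    unfolding I7 by simp
  also have "\<dots> = 4 * ?I * ?I7 * euler_f (7 * m)"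
    by (simp only: mult.assoc)
  also have "fps_cong 7 \<dots> (4 * ?I * ?I7 * ?E ^ 7)"
    using m by (intro fps_cong_mult fps_cong_refl fps_cong_sym[OF euler_f_power_7])
  also have "4 * ?I * ?I7 * ?E ^ 7 = (4 * ?E ^ 6 * ?I7) * (?I * ?E)"
    by (simp add: eval_nat_numeral mult_ac)
  also have "\<dots> = 4 * ?E ^ 6 * ?I7"
    using m by (simp add: euler_inv_f)
  finally have "fps_cong 7 (4 * ?I) (4 * ?E ^ 6 * ?I7)" .
  moreover have "7 dvd (4 * ?E ^ 6 * ?I7) $ n"
    using m n by (intro dvd_nth_mult_supported[of "7 * m" "5 * m"] euler_f_pow_6_dvd_7 fps_supported_euler_inv) auto
  ultimately have "7 dvd (4 * ?I) $ n" by (rule fps_cong_dvd)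
  then have "7 dvd 4 * ?I $ n"
    by (simp add: numeral_fps_const)
  then show ?thesis by presburger
qed

text \<open>An exponent \<open>n\<close> satisfies 12n + 2 = (6i - 1)^2 + (6j - 1)^2. For n = 1
  modulo 7 this is divisible by 7, hence by 49, which fixes \<open>n\<close> modulo 49.\<close>

lemma euler_f_2_square_nth:
  assumes nz: "(euler_f 2 ^ 2) $ n \<noteq> 0" and n: "n mod 7 = 1"
  shows "n mod 49 = 8"
proof -
  have "euler_f 2 ^ 2 = exponent_series (\<lambda>(i, j). 2 * pent i + 2 * pent j) (\<lambda>(i, j). parity_sign i * parity_sign j)"
    unfolding power2_eq_square euler_f_pentagonal[OF zero_less_numeral]
    by (intro exponent_series_mult finite_exponent_fibre mult_exponent_ge pent_ge) auto
  then obtain i j where ij: "2 * pent i + 2 * pent j = n"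
    using nz by (auto simp: exponent_series_def elim!: sum.not_neutral_contains_not_neutral)
  have eq: "12 * int n + 2 = (6 * i - 1) ^ 2 + (6 * j - 1) ^ 2"
    using two_pent[of i] two_pent[of j] unfolding ij[symmetric] by (simp add: power2_eq_square algebra_simps)
  have "7 dvd 12 * int n + 2" using n by presburger
  then have "7 dvd 6 * i - 1" "7 dvd 6 * j - 1"
    unfolding eq by (rule sum_two_squares_dvd_7)+
  then have "7 ^ 2 dvd (6 * i - 1) ^ 2" "7 ^ 2 dvd (6 * j - 1) ^ 2"
    by (auto intro: dvd_power_same)
  then have "49 dvd 12 * int n + 2"
    unfolding eq by (simp add: dvd_add)
  then obtain t where "12 * int n + 2 = 49 * t" ..
  \<comment> \<open>The equation is multiplied by 4, because 4 * 12 = 49 - 1.\<close>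
  then have "int n = 8 + (int n - 4 * t) * 49" by simp
  then have "int n mod 49 = (8 + (int n - 4 * t) * 49) mod 49" by (rule arg_cong)
  also have "\<dots> = 8" unfolding mod_mult_self1 by simp
  finally have "int (n mod 49) = int 8" by (simp add: zmod_int)
  then show ?thesis by (simp only: of_nat_eq_iff)
qed

text \<open>In a nonzero term \<open>i\<close> is 8 modulo 49, so \<open>n - i\<close> is 35 modulo
  49, that is 7k with k = 5 modulo 7: Ramanujan's class.\<close>

lemma euler_f_2_square_div_dvd_7:
  assumes n: "n mod 49 = 43"
  shows "7 dvd (euler_f 2 ^ 2 * euler_inv 7) $ n"
  unfolding fps_mult_nth
proof (rule dvd_sum)
  fix i assume i: "i \<in> {0..n}"
  show "7 dvd (euler_f 2 ^ 2) $ i * euler_inv 7 $ (n - i)"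
  proof (cases "(euler_f 2 ^ 2) $ i = 0 \<or> euler_inv 7 $ (n - i) = 0")
    case False
    then have "7 dvd n - i"
      using fps_supported_euler_inv[of 7] by (auto simp: fps_supported_def)
    then obtain k where k: "n - i = 7 * k" ..
    then have nk: "n = i + 7 * k" using i by simp
    have "n mod 7 = 1"
      using n mod_mod_cancel[of 7 49 n] by simp
    then have "i mod 7 = 1" using nk by simp
    then have i8: "i mod 49 = 8" using euler_f_2_square_nth False by blast
    have "k + 7 * (i div 49) = 7 * (n div 49) + 5"
      using nk n i8 div_mult_mod_eq[of n 49] div_mult_mod_eq[of i 49] by linarith
    then have "(k + 7 * (i div 49)) mod 7 = (5 + 7 * (n div 49)) mod 7"
      by (simp only: add.commute)
    then have k5: "k mod 7 = 5"
      unfolding mod_mult_self2 by simp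
    have "(n - i) mod (7 * 7) = 5 * 7"
      unfolding k mult_mod_right[symmetric] k5 by (rule mult.commute)
    then have "7 dvd euler_inv 7 $ (n - i)"
      by (rule ramanujan_mod_7[rotated]) simp
    then show ?thesis by (rule dvd_mult)
  qed auto
qed

theorem elongated_d_dvd_7:
  assumes n: "n mod 49 = 43"
  shows "7 dvd elongated_d (49 * c + 2) n"
proof -
  let ?D = "Abs_fps (elongated_d (49 * c + 2))"
  let ?S = "euler_f 98 ^ c * euler_inv 49 ^ (3 * c)"
  have E: "fps_cong 7 (euler_f 1 ^ (3 * (49 * c + 2) + 1)) (euler_f 7 * euler_f 49 ^ (3 * c))"
  proof -
    \<comment> \<open>The exponent 3 (49c + 2) + 1 equals 7 (1 + 21c), so Frobenius applies to all
      of it and again to the part 7 * 21c.\<close>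
    have "fps_cong 7 (euler_f 1 ^ (7 * (1 + 7 * (3 * c)))) (euler_f (7 * 1) ^ (1 + 7 * (3 * c)))"
      by (rule euler_f_power_7_mult) simp
    also have "euler_f (7 * 1) ^ (1 + 7 * (3 * c)) = euler_f 7 * euler_f 7 ^ (7 * (3 * c))"
      by simp
    also have "fps_cong 7 \<dots> (euler_f 7 * euler_f (7 * 7) ^ (3 * c))"
      by (intro fps_cong_mult fps_cong_refl euler_f_power_7_mult) simp
    also have "7 * (1 + 7 * (3 * c)) = 3 * (49 * c + 2) + 1" by simp
    finally show ?thesis by simp
  qed
  have E2: "fps_cong 7 (euler_f 2 ^ (49 * c + 2)) (euler_f 2 ^ 2 * euler_f 98 ^ c)"
  proof -
    have "euler_f 2 ^ (49 * c + 2) = euler_f 2 ^ 2 * euler_f 2 ^ (7 * (7 * c))"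
      by (simp flip: power_add)
    also have "fps_cong 7 \<dots> (euler_f 2 ^ 2 * euler_f (7 * 2) ^ (7 * c))"
      by (intro fps_cong_mult fps_cong_refl euler_f_power_7_mult) simp
    also have "fps_cong 7 \<dots> (euler_f 2 ^ 2 * euler_f (7 * (7 * 2)) ^ c)"
      by (intro fps_cong_mult fps_cong_refl euler_f_power_7_mult) simp
    finally show ?thesis by simp
  qed
  have "?D = ?D * (euler_f 7 * euler_inv 7) * (euler_f 49 * euler_inv 49) ^ (3 * c)"
    by (simp add: euler_f_inv)
  also have "\<dots> = ?D * (euler_f 7 * euler_f 49 ^ (3 * c)) * (euler_inv 7 * euler_inv 49 ^ (3 * c))"
    by (simp only: power_mult_distrib mult_ac)
  also have "fps_cong 7 \<dots> (?D * euler_f 1 ^ (3 * (49 * c + 2) + 1) * (euler_inv 7 * euler_inv 49 ^ (3 * c)))"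
    by (intro fps_cong_mult fps_cong_refl fps_cong_sym[OF E])
  also have "\<dots> = euler_f 2 ^ (49 * c + 2) * (euler_inv 7 * euler_inv 49 ^ (3 * c))"
    unfolding elongated_d_gf ..
  also have "fps_cong 7 \<dots> (euler_f 2 ^ 2 * euler_f 98 ^ c * (euler_inv 7 * euler_inv 49 ^ (3 * c)))"
    by (intro fps_cong_mult fps_cong_refl E2)
  also have "\<dots> = (euler_f 2 ^ 2 * euler_inv 7) * ?S"
    by (simp only: mult_ac)
  finally have "fps_cong 7 ?D ((euler_f 2 ^ 2 * euler_inv 7) * ?S)" .
  moreover have "fps_supported 49 ?S"
    by (intro fps_supported_mult fps_supported_power fps_supported_euler_inv
          fps_supported_dvd[OF fps_supported_euler_f, of 98]) auto
  then have "7 dvd ((euler_f 2 ^ 2 * euler_inv 7) * ?S) $ n"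
    using dvd_nth_mult_supported[OF euler_f_2_square_div_dvd_7 _ n] by blast
  ultimately have "7 dvd ?D $ n" by (rule fps_cong_dvd)
  then show ?thesis by simp
qed

section \<open>The theta series of the form 3x ^ 2 + 2y ^ 2\<close>

text \<open>Gauss's series in q times Euler's series in q^2: twice the quotient of
  \<open>euler_f 2 ^ 3\<close> by \<open>euler_f 1\<close>.\<close>

definition theta_gauss_euler :: "int fps" where
  "theta_gauss_euler = exponent_series (\<lambda>(i, j). tri i + 2 * pent j) (\<lambda>(i, j). parity_sign j)"

lemma theta_gauss_euler: "theta_gauss_euler * euler_f 1 = 2 * euler_f 2 ^ 3"
proof -
  have "theta_gauss_euler = exponent_series tri (\<lambda>_. 1) * exponent_series (\<lambda>j. 2 * pent j) parity_sign"
    unfolding theta_gauss_euler_def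
    by (subst exponent_series_mult) (auto intro!: finite_exponent_fibre mult_exponent_ge tri_ge pent_ge)
  also have "\<dots> = exponent_series tri (\<lambda>_. 1) * euler_f 2"
    by (simp add: euler_f_pentagonal)
  finally have "theta_gauss_euler * euler_f 1 = exponent_series tri (\<lambda>_. 1) * euler_f 1 * euler_f 2"
    by (simp only: mult_ac)
  also have "\<dots> = 2 * euler_f 2 ^ 2 * euler_f 2"
    unfolding euler_f_gauss ..
  also have "\<dots> = 2 * euler_f 2 ^ 3"
    by (simp only: power3_eq_cube power2_eq_square mult_ac)
  finally show ?thesis .
qed

text \<open>Multiplying the exponent by 24 and adding 5 = 3 + 2 completes both squares.\<close>

lemma tri_pent_fibre:
  "tri i + 2 * pent j = n \<longleftrightarrow> 3 * (2 * i - 1) ^ 2 + 2 * (6 * j - 1) ^ 2 = 24 * int n + 5"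
proof -
  have "3 * (2 * i - 1) ^ 2 + 2 * (6 * j - 1) ^ 2 = 24 * int (tri i + 2 * pent j) + 5"
    using two_tri[of i] two_pent[of j] by (simp add: power2_eq_square algebra_simps)
  then show ?thesis by auto
qed

lemma parity_sign_diff_odd: "odd k \<Longrightarrow> parity_sign (j - k) = - parity_sign j"
  by (auto simp: parity_sign_def)

text \<open>
  In terms of \<open>x = 2 * i - 1\<close> and \<open>y = 6 * j - 1\<close>, the map \<open>f\<close> below is multiplication of
  \<open>3 * x + y * sqrt (- 6)\<close> by \<open>(1 - sqrt (- 6)) / (1 + sqrt (- 6))\<close>, followed by \<open>x \<mapsto> - x\<close>.
\<close>

lemma binary_form_signed_sum_0:
  fixes n :: nat
  defines "S \<equiv> {(i, j). 3 * (2 * i - 1) ^ 2 + 2 * (6 * j - 1) ^ 2 = 24 * int n + 5}"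
  shows "(\<Sum>(i, j) | (i, j) \<in> S \<and> 7 dvd 2 * i + 12 * j - 3. parity_sign j) = 0" (is "sum ?w ?A = 0")
    and "(\<Sum>(i, j) | (i, j) \<in> S \<and> 7 dvd 2 * i - 12 * j + 1. parity_sign j) = 0" (is "sum _ ?B = 0")
proof -
  define f :: "int \<times> int \<Rightarrow> int \<times> int" where
    "f = (\<lambda>(i, j). (i - (2 * i + 12 * j - 3) div 7, j - (2 * i + 12 * j - 3) div 7))"
  have f: "f p \<in> ?A" "f (f p) = p" "- ?w (f p) = ?w p" if "p \<in> ?A" for p
  proof -
    obtain i j where p: "p = (i, j)" by (cases p)
    from that p obtain k where k: "2 * i + 12 * j - 3 = 7 * k"
      by auto
    \<comment> \<open>Since \<open>k\<close> is odd, the shift of \<open>j\<close> by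
      \<open>k\<close> changes its parity; this is what makes the involution reverse signs.\<close>
    have odd: "odd k" using k by presburger
    have fp: "f p = (i - k, j - k)"
      by (simp add: f_def p k)
    have k': "2 * (i - k) + 12 * (j - k) - 3 = 7 * (- k)"
      using k by simp
    \<comment> \<open>The last summand is the change of the form under a common shift by
      \<open>k\<close>; the chosen \<open>k\<close> is its nonzero root.\<close>
    have "3 * (2 * (i - k) - 1) ^ 2 + 2 * (6 * (j - k) - 1) ^ 2
        = 3 * (2 * i - 1) ^ 2 + 2 * (6 * j - 1) ^ 2 + 12 * k * (7 * k - (2 * i + 12 * j - 3))"
      by (simp add: power2_eq_square algebra_simps)
    then have "3 * (2 * (i - k) - 1) ^ 2 + 2 * (6 * (j - k) - 1) ^ 2
        = 3 * (2 * i - 1) ^ 2 + 2 * (6 * j - 1) ^ 2"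
      unfolding k by simp
    moreover have "7 dvd 2 * (i - k) + 12 * (j - k) - 3"
      unfolding k' by (rule dvd_triv_left)
    ultimately show "f p \<in> ?A"
      using that unfolding fp by (simp add: p S_def)
    have "f (i - k, j - k) = (i, j)"
      unfolding f_def prod.case k' by simp
    then show "f (f p) = p"
      unfolding fp by (simp only: p)
    show "- ?w (f p) = ?w p"
      unfolding fp using odd by (simp add: p parity_sign_diff_odd)
  qed
  have "sum ?w ?A = (\<Sum>p\<in>?A. - ?w p)"
    by (rule sum.reindex_bij_witness[of _ f f]) (erule f(1) f(2) f(3))+
  then show A: "sum ?w ?A = 0"
    by (simp add: sum_negf)
  \<comment> \<open>The reflection \<open>i \<mapsto> 1 - i\<close>, that is x to -x, keeps form and
    sign and exchanges the two linear conditions.\<close>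
  have "sum ?w ?B = sum ?w ?A"
  proof (rule sum.reindex_bij_witness[of _ "\<lambda>(i, j). (1 - i, j)" "\<lambda>(i, j). (1 - i, j)"])
    have 1: "(2 * (1 - i) - 1) ^ 2 = (2 * i - 1 :: int) ^ 2" for i
      by (simp add: power2_eq_square algebra_simps)
    have 2: "7 dvd 2 * (1 - i) + 12 * j - 3 \<longleftrightarrow> 7 dvd 2 * i - 12 * j + 1" for i j :: int
      using dvd_minus_iff[of 7 "2 * i - 12 * j + 1"] by (simp add: algebra_simps)
    have 3: "7 dvd 2 * (1 - i) - 12 * j + 1 \<longleftrightarrow> 7 dvd 2 * i + 12 * j - 3" for i j :: int
      using dvd_minus_iff[of 7 "2 * i + 12 * j - 3"] by (simp add: algebra_simps)
    show "(case p of (i, j) \<Rightarrow> (1 - i, j)) \<in> ?A" if "p \<in> ?B" for p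
      using that unfolding S_def by (cases p) (simp only: mem_Collect_eq prod.case 1 2)
    show "(case p of (i, j) \<Rightarrow> (1 - i, j)) \<in> ?B" if "p \<in> ?A" for p
      using that unfolding S_def by (cases p) (simp only: mem_Collect_eq prod.case 1 3)
  qed auto
  with A show "sum ?w ?B = 0" by simp
qed

text \<open>Modulo 7 the form 3x^2 + 2y^2 is 3 (x + 2y)(x - 2y), with x = 2i - 1 and y = 6j - 1. So
  for n = 3 modulo 7 every representation lies in \<open>A\<close> or \<open>B\<close>. Their signed
  sums vanish, and inclusion-exclusion leaves \<open>A \<inter> B\<close>, where 7 divides x and y
  and thus 49 divides 24n + 5.\<close>

lemma theta_gauss_euler_nth:
  assumes nz: "theta_gauss_euler $ n \<noteq> 0" and n: "n mod 7 = 3"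
  shows "n mod 49 = 10"
proof -
  define S where "S = {(i, j). 3 * (2 * i - 1) ^ 2 + 2 * (6 * j - 1) ^ 2 = 24 * int n + 5}"
  define A where "A = {(i, j). (i, j) \<in> S \<and> 7 dvd 2 * i + 12 * j - 3}"
  define B where "B = {(i, j). (i, j) \<in> S \<and> 7 dvd 2 * i - 12 * j + 1}"
  have "theta_gauss_euler $ n = (\<Sum>(i, j)\<in>S. parity_sign j)"
  proof -
    have "{p. (case p of (i, j) \<Rightarrow> tri i + 2 * pent j) = n} = S"
      unfolding S_def by (rule Collect_cong) (simp only: split_def tri_pent_fibre)
    then show ?thesis by (simp add: theta_gauss_euler_def exponent_series_def)
  qed
  have 7: "7 dvd 24 * int n + 5"
  proof -
    have "n = 7 * (n div 7) + 3"
      using div_mult_mod_eq[of n 7] n by (simp only: mult.commute)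
    then obtain d where "n = 7 * d + 3" ..
    then have "24 * int n + 5 = 7 * (24 * int d + 11)" by simp
    then show ?thesis by (rule dvdI)
  qed
  have S: "S = A \<union> B"
  proof -
    have "(i, j) \<in> A \<union> B" if "(i, j) \<in> S" for i j
    proof -
      have "3 * ((2 * i + 12 * j - 3) * (2 * i - 12 * j + 1))
          = 3 * (2 * i - 1) ^ 2 + 2 * (6 * j - 1) ^ 2 - 7 * (2 * (6 * j - 1) ^ 2)"
        by (simp add: power2_eq_square algebra_simps)
      then have "3 * ((2 * i + 12 * j - 3) * (2 * i - 12 * j + 1))
          = (24 * int n + 5) - 7 * (2 * (6 * j - 1) ^ 2)"
        using that by (simp add: S_def)
      then have "7 dvd 3 * ((2 * i + 12 * j - 3) * (2 * i - 12 * j + 1))"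
        using dvd_diff[OF 7 dvd_triv_left] by metis
      moreover have "prime (7 :: int)" by simp
      moreover have "\<not> 7 dvd (3 :: int)" by simp
      ultimately have "7 dvd 2 * i + 12 * j - 3 \<or> 7 dvd 2 * i - 12 * j + 1"
        by (simp only: prime_dvd_mult_iff) simp
      with that show ?thesis by (auto simp: A_def B_def)
    qed
    then show ?thesis by (auto simp: A_def B_def)
  qed
  have fin: "finite S"
  proof -
    have "S \<subseteq> (\<Union>s\<in>{..n}. {i. tri i = s} \<times> {j. 2 * pent j = n - s})"
      by (auto simp: S_def tri_pent_fibre[symmetric])
    moreover have "finite \<dots>"
      by (intro finite_UN_I finite_cartesian_product finite_exponent_fibre mult_exponent_ge tri_ge pent_ge) auto
    ultimately show ?thesis by (rule finite_subset)
  qed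
  have "(\<Sum>(i, j)\<in>S. parity_sign j) = (\<Sum>(i, j)\<in>A. parity_sign j) + (\<Sum>(i, j)\<in>B. parity_sign j)
       - (\<Sum>(i, j)\<in>A \<inter> B. parity_sign j)"
    using fin unfolding S by (intro sum_Un) auto
  also have "\<dots> = - (\<Sum>(i, j)\<in>A \<inter> B. parity_sign j)"
    using binary_form_signed_sum_0[of n] by (simp add: A_def B_def S_def)
  finally have "A \<inter> B \<noteq> {}"
    using nz \<open>theta_gauss_euler $ n = _\<close> by auto
  then obtain i j where ij: "(i, j) \<in> S" "7 dvd 2 * i + 12 * j - 3" "7 dvd 2 * i - 12 * j + 1"
    by (auto simp: A_def B_def)
  then have "7 dvd 2 * i - 1" "7 dvd 6 * j - 1" by presburger+
  then have "7 ^ 2 dvd (2 * i - 1) ^ 2" "7 ^ 2 dvd (6 * j - 1) ^ 2"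
    by (auto intro: dvd_power_same)
  then have "7 ^ 2 dvd 3 * (2 * i - 1) ^ 2 + 2 * (6 * j - 1) ^ 2"
    by (intro dvd_add dvd_mult)
  then have "49 dvd 24 * int n + 5"
    using ij(1) by (simp add: S_def)
  then obtain t where "24 * int n + 5 = 49 * t" ..
  \<comment> \<open>The equation is doubled, because 2 * 24 = 49 - 1.\<close>
  then have "int n = 10 + (int n - 2 * t) * 49" by simp
  then have "int n mod 49 = (10 + (int n - 2 * t) * 49) mod 49" by (rule arg_cong)
  also have "\<dots> = 10" unfolding mod_mult_self1 by simp
  finally have "int (n mod 49) = int 10" by (simp add: zmod_int)
  then show ?thesis by (simp only: of_nat_eq_iff)
qed

text \<open>In a nonzero term \<open>i\<close> is 10 modulo 49, so \<open>n - i = 14 * k\<close> is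
  21 modulo 49. Then 2k = 3 and k = 5 modulo 7, Ramanujan's class again.\<close>

lemma theta_gauss_euler_div_dvd_7:
  assumes n: "n mod 49 = 31"
  shows "7 dvd (theta_gauss_euler * euler_inv 14) $ n"
  unfolding fps_mult_nth
proof (rule dvd_sum)
  fix i assume i: "i \<in> {0..n}"
  show "7 dvd theta_gauss_euler $ i * euler_inv 14 $ (n - i)"
  proof (cases "theta_gauss_euler $ i = 0 \<or> euler_inv 14 $ (n - i) = 0")
    case False
    then have "14 dvd n - i"
      using fps_supported_euler_inv[of 14] by (auto simp: fps_supported_def)
    then obtain k where k: "n - i = 14 * k" ..
    then have nk: "n = i + 7 * (2 * k)" using i by simp
    have "n mod 7 = 3"
      using n mod_mod_cancel[of 7 49 n] by simp
    then have "i mod 7 = 3" using nk by (simp only: mod_mult_self2)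
    then have i10: "i mod 49 = 10" using theta_gauss_euler_nth False by blast
    define a b where "a = i div 49" and "b = n div 49"
    have "i = 49 * a + 10" "n = 49 * b + 31"
      using n i10 div_mult_mod_eq[of n 49] div_mult_mod_eq[of i 49] by (simp_all only: a_def b_def mult.commute)
    \<comment> \<open>This is 2k = 7 (b - a) + 3 multiplied by 4, the inverse of 2 modulo 7, with
      all terms kept nonnegative.\<close>
    then have "k + 7 * (4 * a + k) = 5 + 7 * (4 * b + 1)"
      using nk by presburger
    then have "(k + 7 * (4 * a + k)) mod 7 = (5 + 7 * (4 * b + 1)) mod 7"
      by (rule arg_cong)
    then have k5: "k mod 7 = 5"
      unfolding mod_mult_self2 by simp
    have "(n - i) mod (14 * 7) = 14 * 5"
      unfolding k mult_mod_right[symmetric] k5 ..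
    then have "(n - i) mod (7 * 14) = 5 * 14"
      by (simp only: mult.commute)
    then have "7 dvd euler_inv 14 $ (n - i)"
      by (rule ramanujan_mod_7[rotated]) simp
    then show ?thesis by (rule dvd_mult)
  qed auto
qed

section \<open>Generalized cubic partitions\<close>

text \<open>Partitions with parts from a fixed set; for finite \<open>U\<close> the generating
  function is the inverse of a finite product, and the coloured partitions arise as a limit.\<close>

definition weighted_multisets :: "('a \<Rightarrow> nat) \<Rightarrow> 'a set \<Rightarrow> nat \<Rightarrow> 'a multiset set" where
  "weighted_multisets wt U n = {P. set_mset P \<subseteq> U \<and> (\<Sum>x\<in>#P. wt x) = n}"

lemma finite_weighted_multisets:
  assumes "finite U" "\<And>x. x \<in> U \<Longrightarrow> wt x > 0"
  shows "finite (weighted_multisets wt U n)"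
proof (rule finite_subset)
  show "weighted_multisets wt U n \<subseteq> (\<Union>i\<le>n. multisets_of_size U i)"
  proof
    fix P assume P: "P \<in> weighted_multisets wt U n"
    have "size P \<le> (\<Sum>x \<in># P. wt x)"
      unfolding size_eq_sum_mset using P assms(2)
      by (intro sum_mset_mono) (auto simp: weighted_multisets_def Suc_le_eq)
    then show "P \<in> (\<Union>i\<le>n. multisets_of_size U i)"
      using P by (auto simp: weighted_multisets_def multisets_of_size_def)
  qed
  show "finite (\<Union>i\<le>n. multisets_of_size U i)"
    using assms(1) by (intro finite_UN_I) auto
qed

lemma weighted_multisets_gf:
  assumes "finite U" "\<And>x. x \<in> U \<Longrightarrow> wt x > 0"
  shows "Abs_fps (\<lambda>n. int (card (weighted_multisets wt U n))) * (\<Prod>x\<in>U. 1 - fps_X ^ wt x) = 1"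
  using assms
proof (induction U rule: finite_induct)
  case empty
  have "weighted_multisets wt {} n = (if n = 0 then {{#}} else {})" for n
    by (auto simp: weighted_multisets_def)
  then show ?case by (auto simp: fps_eq_iff)
next
  case (insert x U)
  let ?M = "weighted_multisets wt (insert x U)" and ?N = "weighted_multisets wt U"
  have fin: "finite (?M n)" "finite (?N n)" for n
    using insert by (auto intro!: finite_weighted_multisets)
  \<comment> \<open>A multiset either avoids \<open>x\<close> or arises by adding one copy of
    \<open>x\<close> to a multiset that may still contain \<open>x\<close>.\<close>
  have step: "card (?M n) = card (?N n) + (if n < wt x then 0 else card (?M (n - wt x)))" for n
  proof (cases "n < wt x")
    case True
    have "?M n = ?N n"
    proof -
      have "x \<notin># P" if "P \<in> ?M n" for P
      proof
        assume "x \<in># P"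
        then obtain Q where "P = add_mset x Q" by (blast dest: multi_member_split)
        then show False using that True by (simp add: weighted_multisets_def)
      qed
      then show ?thesis by (auto simp: weighted_multisets_def)
    qed
    then show ?thesis using True by simp
  next
    case False
    have "?M n = ?N n \<union> add_mset x ` ?M (n - wt x)"
    proof (intro equalityI subsetI)
      fix P assume P: "P \<in> ?M n"
      show "P \<in> ?N n \<union> add_mset x ` ?M (n - wt x)"
      proof (cases "x \<in># P")
        case True
        then obtain Q where "P = add_mset x Q" by (blast dest: multi_member_split)
        then show ?thesis using P by (auto simp: weighted_multisets_def)
      qed (use P in \<open>auto simp: weighted_multisets_def\<close>)
    qed (use False in \<open>auto simp: weighted_multisets_def\<close>)
    moreover have "?N n \<inter> add_mset x ` ?M (n - wt x) = {}"
    proof (rule equals0I)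
      fix P assume P: "P \<in> ?N n \<inter> add_mset x ` ?M (n - wt x)"
      then obtain Q where "P = add_mset x Q" by blast
      then have "x \<in> U" using P by (simp add: weighted_multisets_def)
      with insert.hyps show False by simp
    qed
    moreover have "card (add_mset x ` ?M (n - wt x)) = card (?M (n - wt x))"
      by (intro card_image inj_onI) simp
    ultimately show ?thesis
      using fin False by (simp add: card_Un_disjoint)
  qed
  have "Abs_fps (\<lambda>n. int (card (?M n))) * (1 - fps_X ^ wt x) = Abs_fps (\<lambda>n. int (card (?N n)))"
  proof (rule fps_ext)
    fix n
    show "(Abs_fps (\<lambda>n. int (card (?M n))) * (1 - fps_X ^ wt x)) $ n = Abs_fps (\<lambda>n. int (card (?N n))) $ n"
      using step[of n] by (simp add: right_diff_distrib fps_X_power_mult_right_nth)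
  qed
  then have "Abs_fps (\<lambda>n. int (card (?M n))) * (\<Prod>x\<in>insert x U. 1 - fps_X ^ wt x)
      = Abs_fps (\<lambda>n. int (card (?N n))) * (\<Prod>x\<in>U. 1 - fps_X ^ wt x)"
    using insert.hyps by (simp flip: mult.assoc)
  then show ?case using insert by simp
qed

text \<open>Each size gives one factor, and each even size \<open>k - 1\<close> further ones. The
  even bound \<open>2 * M\<close> makes the latter exactly a q-factorial of length
  \<open>M\<close>.\<close>

lemma prod_coloured_parts:
  assumes "k \<ge> 1"
  shows "(\<Prod>x\<in>(SIGMA s:{1..2 * M}. {..<if even s then k else 1}). 1 - fps_X ^ fst x :: int fps)
    = qfact (fps_X ^ 1) (2 * M) * qfact (fps_X ^ 2) M ^ (k - 1)"
proof -
  obtain l where l: "k = Suc l" using assms by (cases k) auto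
  have "(\<Prod>s\<in>{1..2 * M}. (1 - fps_X ^ s) ^ (if even s then k else 1))
      = (qfact (fps_X ^ 1) (2 * M) * qfact (fps_X ^ 2) M ^ (k - 1) :: int fps)"
  proof (induction M)
    case 0
    then show ?case by simp
  next
    case (Suc M)
    have e: "2 * Suc M = Suc (Suc (2 * M))" by simp
    have x: "(fps_X ^ 2) ^ Suc M = (fps_X ^ Suc (Suc (2 * M)) :: int fps)"
      unfolding power_mult[symmetric] e ..
    show ?case
      unfolding e qfact_Suc x using Suc
      by (simp add: l power_mult_distrib mult_ac del: power_Suc) (simp add: mult_ac)
  qed
  moreover have "(\<Prod>x\<in>(SIGMA s:{1..2 * M}. {..<if even s then k else 1}). 1 - fps_X ^ fst x :: int fps)
      = (\<Prod>s\<in>{1..2 * M}. \<Prod>c\<in>{..<if even s then k else 1}. 1 - fps_X ^ s)"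
    by (subst prod.Sigma) (simp_all add: split_def)
  ultimately show ?thesis
    by (simp only: prod_constant card_lessThan)
qed

theorem gen_cubic_a_gf:
  assumes "k \<ge> 1"
  shows "Abs_fps (\<lambda>n. int (gen_cubic_a k n)) * euler_f 1 * euler_f 2 ^ (k - 1) = 1"
proof -
  define U where "U M = (SIGMA s:{1..2 * M}. {..<if even s then k else 1})" for M :: nat
  define F where "F M = Abs_fps (\<lambda>n. int (card (weighted_multisets fst (U M) n)))" for M
  have F: "F M * qfact (fps_X ^ 1) (2 * M) * qfact (fps_X ^ 2) M ^ (k - 1) = 1" for M
    using weighted_multisets_gf[of "U M" fst] prod_coloured_parts[OF assms, of M]
    by (auto simp: F_def U_def mult.assoc)
  have "F \<longlonglongrightarrow> Abs_fps (\<lambda>n. int (gen_cubic_a k n))"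
  proof (rule tendsto_fpsI)
    fix n
    show "\<forall>\<^sub>F M in sequentially. F M $ n = Abs_fps (\<lambda>n. int (gen_cubic_a k n)) $ n"
      \<comment> \<open>No part of a partition of \<open>n\<close> exceeds \<open>n\<close>, so from
        \<open>M = n\<close> on every partition is counted.\<close>
      using eventually_ge_at_top[of n]
    proof eventually_elim
      case (elim M)
      have "weighted_multisets fst (U M) n = gen_cubic_partitions k n"
      proof (intro equalityI subsetI)
        fix P assume "P \<in> gen_cubic_partitions k n"
        then have P: "\<forall>(s, c) \<in># P. s > 0 \<and> c < (if even s then k else 1)" "(\<Sum>x\<in>#P. fst x) = n"
          by (auto simp: gen_cubic_partitions_def split_def)
        have "(s, c) \<in> U M" if sc: "(s, c) \<in># P" for s c
        proof -
          obtain Q where "P = add_mset (s, c) Q"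
            using multi_member_split[OF sc] by blast
          then have "s \<le> n" using P(2) by auto
          then show ?thesis using P(1) sc elim by (auto simp: U_def)
        qed
        then show "P \<in> weighted_multisets fst (U M) n"
          using P(2) by (auto simp: weighted_multisets_def)
      next
        fix P assume P: "P \<in> weighted_multisets fst (U M) n"
        then have "\<forall>(s, c) \<in># P. (s, c) \<in> U M"
          by (auto simp: weighted_multisets_def)
        then have "\<forall>(s, c) \<in># P. s > 0 \<and> c < (if even s then k else 1)"
          by (fastforce simp: U_def)
        then show "P \<in> gen_cubic_partitions k n"
          using P by (simp add: weighted_multisets_def gen_cubic_partitions_def split_def)
      qed
      then show ?case by (simp add: F_def gen_cubic_a_def)
    qed
  qed
  moreover have "filterlim (\<lambda>n::nat. 2 * n) at_top at_top"
    by (auto intro!: filterlim_subseq strict_monoI)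
  ultimately have "(\<lambda>M. F M * qfact (fps_X ^ 1) (2 * M) * qfact (fps_X ^ 2) M ^ (k - 1))
      \<longlonglongrightarrow> Abs_fps (\<lambda>n. int (gen_cubic_a k n)) * euler_f 1 * euler_f 2 ^ (k - 1)"
    by (intro tendsto_mult_fps tendsto_power_fps qfact_tendsto filterlim_ident) auto
  then show ?thesis
    unfolding F by (simp add: LIMSEQ_const_iff)
qed

text \<open>Enlarging the denominator by \<open>euler_f 2 ^ 3\<close> raises its exponent to 49c +
  7, a multiple of 7, while the numerator becomes the theta series. The doubling from that series is
  removed at the end, 2 being invertible modulo 7.\<close>

theorem gen_cubic_a_dvd_7:
  assumes n: "n mod 49 = 31"
  shows "7 dvd int (gen_cubic_a (49 * c + 5) n)"
proof -
  let ?A = "Abs_fps (\<lambda>n. int (gen_cubic_a (49 * c + 5) n))" and ?H = theta_gauss_euler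
  have A: "?A * euler_f 1 * euler_f 2 ^ (49 * c + 4) = 1"
  proof -
    have e: "49 * c + 5 - 1 = 49 * c + 4" by simp
    show ?thesis
      by (rule gen_cubic_a_gf[of "49 * c + 5", unfolded e]) simp
  qed
  have E2: "fps_cong 7 (euler_f 2 ^ (49 * c + 7)) (euler_f 14 * euler_f 98 ^ c)"
  proof -
    have "fps_cong 7 (euler_f 2 ^ (7 * (1 + 7 * c))) (euler_f (7 * 2) ^ (1 + 7 * c))"
      by (intro euler_f_power_7_mult) simp
    also have "euler_f (7 * 2) ^ (1 + 7 * c) = euler_f 14 * euler_f 14 ^ (7 * c)"
      by simp
    also have "fps_cong 7 \<dots> (euler_f 14 * euler_f (7 * 14) ^ c)"
      by (intro fps_cong_mult fps_cong_refl euler_f_power_7_mult) simp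
    also have "7 * (1 + 7 * c) = 49 * c + 7" by simp
    finally show ?thesis by simp
  qed
  have H: "?H = 2 * ?A * euler_f 2 ^ (49 * c + 7)"
  proof -
    have "?H = ?H * (?A * euler_f 1 * euler_f 2 ^ (49 * c + 4))"
      unfolding A by simp
    also have "\<dots> = ?A * euler_f 2 ^ (49 * c + 4) * (?H * euler_f 1)"
      by (simp only: mult_ac)
    also have "\<dots> = 2 * ?A * (euler_f 2 ^ (49 * c + 4) * euler_f 2 ^ 3)"
      unfolding theta_gauss_euler by (simp only: mult_ac)
    also have "euler_f 2 ^ (49 * c + 4) * euler_f 2 ^ 3 = euler_f 2 ^ (49 * c + 7)"
    proof -
      have "49 * c + 7 = (49 * c + 4) + 3" by simp
      then show ?thesis by (simp only: power_add)
    qed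
    finally show ?thesis .
  qed
  \<comment> \<open>Multiplying by these trivial factors allows the Frobenius congruence
    \<open>E2\<close> to be applied to Euler products only, not to their inverses.\<close>
  have "2 * ?A = 2 * ?A * (euler_f 14 * euler_inv 14) * (euler_f 98 * euler_inv 98) ^ c"
    by (simp add: euler_f_inv)
  also have "\<dots> = 2 * ?A * (euler_f 14 * euler_f 98 ^ c) * (euler_inv 14 * euler_inv 98 ^ c)"
    by (simp only: power_mult_distrib mult_ac)
  also have "fps_cong 7 \<dots> (2 * ?A * euler_f 2 ^ (49 * c + 7) * (euler_inv 14 * euler_inv 98 ^ c))"
    by (intro fps_cong_mult fps_cong_refl fps_cong_sym[OF E2])
  also have "\<dots> = (?H * euler_inv 14) * euler_inv 98 ^ c"
    unfolding H[symmetric] by (simp only: mult.assoc)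
  finally have "fps_cong 7 (2 * ?A) ((?H * euler_inv 14) * euler_inv 98 ^ c)" .
  moreover have "fps_supported 49 (euler_inv 98 ^ c)"
    by (intro fps_supported_power fps_supported_dvd[OF fps_supported_euler_inv, of 98]) auto
  then have "7 dvd ((?H * euler_inv 14) * euler_inv 98 ^ c) $ n"
    using dvd_nth_mult_supported[OF theta_gauss_euler_div_dvd_7 _ n] by blast
  ultimately have "7 dvd (2 * ?A) $ n" by (rule fps_cong_dvd)
  then have "7 dvd 2 * int (gen_cubic_a (49 * c + 5) n)"
    by (simp add: numeral_fps_const)
  then show ?thesis by presburger
qed

theorem theorem1p1:
  fixes c n :: nat
  shows "[gen_cubic_a (49 * c + 5) (49 * n + 31) = 0] (mod 7)
       \<and> [elongated_d (49 * c + 2) (49 * n + 43) = 0] (mod 7)"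
proof
  have "7 dvd int (gen_cubic_a (49 * c + 5) (49 * n + 31))"
    by (rule gen_cubic_a_dvd_7) simp
  then have "int 7 dvd int (gen_cubic_a (49 * c + 5) (49 * n + 31))"
    by (simp only: of_nat_numeral)
  then show "[gen_cubic_a (49 * c + 5) (49 * n + 31) = 0] (mod 7)"
    by (simp only: of_nat_dvd_iff cong_0_iff)
  have "7 dvd elongated_d (49 * c + 2) (49 * n + 43)"
    by (rule elongated_d_dvd_7) simp
  then show "[elongated_d (49 * c + 2) (49 * n + 43) = 0] (mod 7)"
    by (simp only: cong_0_iff)
qed

end
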